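(* Let $\mathcal{T}$ be a Galton-Watson tree whose offspring distribution $\{p_k\}_{k\ge 0}$ satisfies $p_0=0$, $p_1\neq 1$ and $1<m:=\sum_{k}kp_k<\infty$. Then for every $0<\lambda<m$, $\beta_\lambda>0\vee\log\lambda$ (i.e. $\beta_\lambda>\max\{0,\log\lambda\}$).
   Context: $\mathcal{T}$ is the random rooted family tree, with root $o$, of a Galton-Watson branching process with offspring distribution $\{p_k\}_{k\ge0}$ started from one individual; its law is $\mathbb{P}_{\rm GW}$. $\Sigma$ is the set of infinite rays $\omega=(\omega_0=o,\omega_1,\omega_2,\dots)$ from the root (each $\omega_n$ a child of $\omega_{n-1}$), $[\omega]_n:=\omega_n$, and $\Sigma(x)$ is the set of rays passing through the vertex $x$. $\Sigma$ carries the ultrametric $d(\omega,\eta)=e^{-N(\omega,\eta)}$, where $N(\omega,\eta)=\max\{n\ge 0:[\omega]_n=[\eta]_n\}$ for $\omega\ne\eta$, and $d(\omega,\omega)=0$. The $\lambda$-biased random walk on a rooted tree: from a vertex $u\neq o$ with $k$ children it moves to the parent with probability $\lambda/(\lambda+k)$ and to each child with probability $1/(\lambda+k)$; from $o$ it moves to a uniformly chosen child. For $0<\lambda<m$ it is transient for $\mathbb{P}_{\rm GW}$-a.e. $\mathcal{T}$, and ${\rm HARM}^\lambda_{\mathcal{T}}$ is the law on $\Sigma$ of the limiting ray of the walk started at $o$. By a known theorem of Lyons, Pemantle and Peres, for $0<\lambda<m$ there is a deterministic constant $\beta_\lambda$ which is $\mathbb{P}_{\rm GW}$-a.s. equal to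 the Hausdorff dimension (with respect to $d$) of the measure ${\rm HARM}^\lambda_{\mathcal{T}}$, and $\mathbb{P}_{\rm GW}$-a.s., $-\lim_{n\to\infty}\frac1n\log{\rm HARM}^\lambda_{\mathcal{T}}(\Sigma([\omega]_n))=\beta_\lambda$ for ${\rm HARM}^\lambda_{\mathcal{T}}$-a.e. $\omega$. *)

theory Defs
  imports "HOL-Probability.Probability"
begin

text \<open>
  Rooted plane trees are written in Ulam--Harris notation: a vertex is a finite list of
  natural numbers, the root is the empty list, the children of \<open>u\<close> are among the
  lists \<open>u @ [i]\<close>, and the parent of \<open>u \<noteq> []\<close> is \<open>butlast u\<close>.
\<close>

type_synonym vertex = "nat list"

definition children :: "vertex set \<Rightarrow> vertex \<Rightarrow> vertex set" where
  "children T u = {v \<in> T. \<exists>i. v = u @ [i]}"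

definition gw_offspring :: "nat pmf \<Rightarrow> (vertex \<Rightarrow> nat) measure" where
  "gw_offspring p = (\<Pi>\<^sub>M u\<in>UNIV. measure_pmf p)"

text \<open>
  The family tree in which individual \<open>u\<close> has the \<open>\<nu> u\<close> children \<open>u @ [0], \<dots>, u @ [\<nu> u - 1]\<close>.
  For \<open>\<nu>\<close> distributed as \<open>gw_offspring p\<close> it is the Galton--Watson tree.
\<close>

definition gw_tree :: "(vertex \<Rightarrow> nat) \<Rightarrow> vertex set" where
  "gw_tree \<nu> = {u. \<forall>i<length u. u ! i < \<nu> (take i u)}"


definition rays :: "vertex set \<Rightarrow> (nat \<Rightarrow> vertex) set" where
  "rays T = {\<omega>. \<omega> 0 = [] \<and> (\<forall>n. \<omega> (Suc n) \<in> children T (\<omega> n))}"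

definition rays_through :: "vertex set \<Rightarrow> vertex \<Rightarrow> (nat \<Rightarrow> vertex) set" where
  "rays_through T x = {\<omega> \<in> rays T. x \<in> range \<omega>}"

definition ray_dist :: "(nat \<Rightarrow> vertex) \<Rightarrow> (nat \<Rightarrow> vertex) \<Rightarrow> real" where
  "ray_dist \<omega> \<eta> = (if \<omega> = \<eta> then 0 else exp (- real (Max {n. \<omega> n = \<eta> n})))"


text \<open>
  The notions below refer to a metric space with carrier \<open>S\<close> and metric \<open>d\<close>. Only exponents
  \<open>s > 0\<close> are used, so that sets of diameter zero contribute \<open>0 powr s = 0\<close> as they should.
\<close>

definition set_diam :: "('a \<Rightarrow> 'a \<Rightarrow> real) \<Rightarrow> 'a set \<Rightarrow> ennreal" where
  "set_diam d A = (SUP x\<in>A. SUP y\<in>A. ennreal (d x y))"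

definition hausdorff_pre ::
    "'a set \<Rightarrow> ('a \<Rightarrow> 'a \<Rightarrow> real) \<Rightarrow> real \<Rightarrow> real \<Rightarrow> 'a set \<Rightarrow> ennreal" where
  "hausdorff_pre S d s \<delta> E =
     (INF U \<in> {U :: nat \<Rightarrow> 'a set. (\<forall>i. U i \<subseteq> S \<and> set_diam d (U i) \<le> ennreal \<delta>) \<and> E \<subseteq> (\<Union>i. U i)}.
        \<Sum>i. ennreal (enn2real (set_diam d (U i)) powr s))"

definition hausdorff_outer ::
    "'a set \<Rightarrow> ('a \<Rightarrow> 'a \<Rightarrow> real) \<Rightarrow> real \<Rightarrow> 'a set \<Rightarrow> ennreal" where
  "hausdorff_outer S d s E = (SUP \<delta>\<in>{0<..}. hausdorff_pre S d s \<delta> E)"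

definition hausdorff_dim :: "'a set \<Rightarrow> ('a \<Rightarrow> 'a \<Rightarrow> real) \<Rightarrow> 'a set \<Rightarrow> ereal" where
  "hausdorff_dim S d E = (INF s\<in>{s. 0 < s \<and> hausdorff_outer S d s E = 0}. ereal s)"

text \<open>The dimension of a measure is the least dimension of a set of full measure.\<close>

definition measure_hausdorff_dim ::
    "'a set \<Rightarrow> ('a \<Rightarrow> 'a \<Rightarrow> real) \<Rightarrow> 'a measure \<Rightarrow> ereal" where
  "measure_hausdorff_dim S d \<mu> =
     (INF E\<in>{E \<in> sets \<mu>. E \<subseteq> S \<and> space \<mu> - E \<in> null_sets \<mu>}. hausdorff_dim S d E)"


text \<open>
  The lemma \<open>pmf_biased_step\<close> below recovers the probabilities
  \<open>\<lambda> / (\<lambda> + k)\<close> and \<open>1 / (\<lambda> + k)\<close> from this two-stage description.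
\<close>

definition biased_step :: "real \<Rightarrow> vertex set \<Rightarrow> vertex \<Rightarrow> vertex pmf" where
  "biased_step lam T u =
     (if u = [] then pmf_of_set (children T u)
      else bernoulli_pmf (lam / (lam + card (children T u))) \<bind>
        (\<lambda>up. if up then return_pmf (butlast u) else pmf_of_set (children T u)))"

lemma pmf_biased_step:
  assumes "0 < lam" "u \<noteq> []" "finite (children T u)" "children T u \<noteq> {}"
  shows "pmf (biased_step lam T u) v =
    (if v = butlast u then lam / (lam + card (children T u))
     else if v \<in> children T u then 1 / (lam + card (children T u)) else 0)"
proof -
  define k where "k = real (card (children T u))"
  have k: "k > 0"
    using assms by (simp add: k_def card_gt_0_iff)
  have "butlast u \<notin> children T u"
  proof
    assume "butlast u \<in> children T u"
    then obtain i where "butlast u = u @ [i]" by (auto simp: children_def)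
    then have "length (butlast u) = length (u @ [i])" by simp
    then show False by simp
  qed
  moreover have "1 - lam / (lam + k) = k / (lam + k)" "0 \<le> lam / (lam + k)" "lam / (lam + k) \<le> 1"
    using k assms(1) by (auto simp: field_simps)
  ultimately show ?thesis
    using assms k unfolding biased_step_def
    by (auto simp: pmf_bind pmf_of_set k_def[symmetric] indicator_def)
qed

text \<open>
  The walk started at \<open>x\<close> is a Markov chain, whose law on the space of trajectories is supplied
  by the Ionescu-Tulcea theorem; \<open>biased_kernel lam T x n X\<close> is the conditional law
  of the position at time \<open>n\<close> given the trajectory \<open>X\<close> before time \<open>n\<close>.
\<close>

definition biased_kernel ::
    "real \<Rightarrow> vertex set \<Rightarrow> vertex \<Rightarrow> nat \<Rightarrow> (nat \<Rightarrow> vertex) \<Rightarrow> vertex measure" where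
  "biased_kernel lam T x n X =
     measure_pmf (case n of 0 \<Rightarrow> return_pmf x | Suc k \<Rightarrow> biased_step lam T (X k))"

lemma Ionescu_Tulcea_biased_kernel:
  "Ionescu_Tulcea (biased_kernel lam T x) (\<lambda>_. count_space UNIV)"
proof (rule Ionescu_Tulcea.intro)
  fix n and X :: "nat \<Rightarrow> vertex"
  show "prob_space (biased_kernel lam T x n X)"
    unfolding biased_kernel_def by (rule measure_pmf.prob_space_axioms)
next
  fix n
  have pm: "(\<lambda>u. measure_pmf (f u)) \<in> measurable (count_space UNIV) (subprob_algebra (count_space UNIV))"
    for f :: "vertex \<Rightarrow> vertex pmf"
    using measurable_measure_pmf by simp
  show "biased_kernel lam T x n
      \<in> measurable (Pi\<^sub>M {0..<n} (\<lambda>_. count_space UNIV)) (subprob_algebra (count_space UNIV))"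
  proof (cases n)
    case 0
    then show ?thesis
      using measure_pmf_in_subprob_algebra[of "return_pmf x"] by (auto simp: biased_kernel_def[abs_def])
  next
    case (Suc k)
    have "(\<lambda>X. X k) \<in> measurable (Pi\<^sub>M {0..<n} (\<lambda>_. count_space UNIV)) (count_space (UNIV :: vertex set))"
      using Suc by (intro measurable_component_singleton) auto
    from measurable_compose[OF this pm[of "biased_step lam T"]]
    show ?thesis by (simp add: biased_kernel_def[abs_def] Suc)
  qed
qed

definition biased_walk :: "real \<Rightarrow> vertex set \<Rightarrow> vertex \<Rightarrow> (nat \<Rightarrow> vertex) measure" where
  "biased_walk lam T x =
     projective_family.lim UNIV (Ionescu_Tulcea.CI (biased_kernel lam T x) (\<lambda>_. count_space UNIV))
       (\<lambda>_. count_space UNIV)"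

lemma sets_biased_walk: "sets (biased_walk lam T x) = sets (\<Pi>\<^sub>M n\<in>UNIV. count_space UNIV)"
proof -
  interpret Ionescu_Tulcea "biased_kernel lam T x" "\<lambda>_. count_space UNIV"
    by (rule Ionescu_Tulcea_biased_kernel)
  show ?thesis unfolding biased_walk_def by (rule PF.sets_lim)
qed

lemma prob_space_biased_walk: "prob_space (biased_walk lam T x)"
proof -
  interpret Ionescu_Tulcea "biased_kernel lam T x" "\<lambda>_. count_space UNIV"
    by (rule Ionescu_Tulcea_biased_kernel)
  have "emeasure PF.lim (PF.emb UNIV {} (space (Pi\<^sub>M {} (\<lambda>_. count_space UNIV)))) 
     = emeasure (CI {}) (space (Pi\<^sub>M {} (\<lambda>_. count_space UNIV)))"
    by (rule lim) auto
  also have "\<dots> = 1"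
    using PF.prob_space_P[of "{}"] PF.space_P[of "{}"] prob_space.emeasure_space_1 by fastforce
  also have "PF.emb UNIV {} (space (Pi\<^sub>M {} (\<lambda>_. count_space UNIV))) = space PF.lim"
    by (auto simp: prod_emb_def space_PiM)
  finally show ?thesis unfolding biased_walk_def by (intro prob_spaceI)
qed

lemma emeasure_biased_walk_cylinder:
  "emeasure (biased_walk lam T x) {X. \<forall>i\<le>n. X i = xs i} =
  (if xs 0 = x then \<Prod>i<n. ennreal (pmf (biased_step lam T (xs i)) (xs (Suc i))) else 0)"
proof -
  interpret Ionescu_Tulcea "biased_kernel lam T x" "\<lambda>_. count_space UNIV"
    by (rule Ionescu_Tulcea_biased_kernel)
  define A where "A n = {restrict xs {0..<n}}" for n :: nat
  have A[measurable]: "A n \<in> sets (Pi\<^sub>M {0..<n} (\<lambda>_. count_space UNIV))" for n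
  proof -
    have "A n = PiE {0..<n} (\<lambda>i. {xs i})" unfolding A_def by (auto simp: PiE_iff extensional_def fun_eq_iff)
    then show ?thesis by (auto intro!: sets_PiM_I_finite)
  qed
  have step: "emeasure (C 0 (Suc n) (\<lambda>_. undefined)) (A (Suc n)) =
     emeasure (C 0 n (\<lambda>_. undefined)) (A n) * emeasure (biased_kernel lam T x n xs) {xs n}" for n
  proof -
    have "emeasure (C 0 (Suc n) (\<lambda>_. undefined)) (A (Suc n)) = (\<integral>\<^sup>+ w. emeasure (eP n w) (A (Suc n)) \<partial>C 0 n (\<lambda>_. undefined))"
      by (simp, subst emeasure_bind[where N="Pi\<^sub>M {0..<Suc n} (\<lambda>_. count_space UNIV)"]) (auto simp: space_C space_PiM measurable_cong_sets[OF sets_C refl])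
    also have "\<dots> = (\<integral>\<^sup>+ w. emeasure (biased_kernel lam T x n xs) {xs n} * indicator (A n) w \<partial>C 0 n (\<lambda>_. undefined))"
    proof (intro nn_integral_cong)
      fix w assume w: "w \<in> space (C 0 n (\<lambda>_. undefined))"
      then have w': "w \<in> space (Pi\<^sub>M {0..<n} (\<lambda>_. count_space UNIV))" by (simp add: space_C space_PiM)
      have eq: "(\<lambda>x. fun_upd w n x) -` A (Suc n) = (if w \<in> A n then {xs n} else {})"
        using w' unfolding A_def
        by (auto simp: space_PiM PiE_iff extensional_def fun_eq_iff less_Suc_eq split: if_splits) (metis less_irrefl)+
      have k: "w \<in> A n \<Longrightarrow> biased_kernel lam T x n w = biased_kernel lam T x n xs"
        by (cases n) (auto simp: A_def biased_kernel_def)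
      show "emeasure (eP n w) (A (Suc n)) = emeasure (biased_kernel lam T x n xs) {xs n} * indicator (A n) w"
        using emeasure_eP[OF w' A] eq k by (auto simp: indicator_def)
    qed
    also have "\<dots> = emeasure (biased_kernel lam T x n xs) {xs n} * emeasure (C 0 n (\<lambda>_. undefined)) (A n)"
      by (subst nn_integral_cmult_indicator) (auto simp: sets_C space_PiM)
    finally show ?thesis by (simp add: mult.commute)
  qed
  have C: "emeasure (C 0 n (\<lambda>_. undefined)) (A n) = (\<Prod>i<n. emeasure (biased_kernel lam T x i xs) {xs i})" for n
  proof (induction n)
    case 0
    have "emeasure (return (Pi\<^sub>M {0..<0} (\<lambda>_. count_space UNIV)) (\<lambda>_. undefined)) (A 0) = 1"
      by (subst emeasure_return[OF A]) (simp add: A_def restrict_def)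
    then show ?case by simp
  next
    case (Suc n)
    then show ?case using step[of n] by simp
  qed
  have "{X. \<forall>i\<le>n. X i = xs i} = PF.emb UNIV {0..<Suc n} (A (Suc n))"
    by (auto simp: prod_emb_def A_def fun_eq_iff space_PiM restrict_def less_Suc_eq_le) metis
  then have "emeasure (biased_walk lam T x) {X. \<forall>i\<le>n. X i = xs i} = emeasure (CI {0..<Suc n}) (A (Suc n))"
    unfolding biased_walk_def using lim[of "{0..<Suc n}" "A (Suc n)"] A by simp
  also have "\<dots> = emeasure (C 0 (Suc n) (\<lambda>_. undefined)) (A (Suc n))"
    using emeasure_CI[of "{0..<Suc n}" "Suc n" "A (Suc n)"] A by (simp add: prod_emb_id A_def del: C.simps)
  also have "\<dots> = (\<Prod>i<Suc n. emeasure (biased_kernel lam T x i xs) {xs i})" by (rule C)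
  also have "\<dots> = (if xs 0 = x then \<Prod>i<n. ennreal (pmf (biased_step lam T (xs i)) (xs (Suc i))) else 0)"
    by (subst prod.lessThan_Suc_shift) (auto simp: biased_kernel_def emeasure_pmf_single)
  finally show ?thesis .
qed

text \<open>
  The ray to which a trajectory converges: its \<open>n\<close>-th vertex is the one which is
  eventually the ancestor (or self) in generation \<open>n\<close> of the walker.
\<close>

definition limit_ray :: "(nat \<Rightarrow> vertex) \<Rightarrow> (nat \<Rightarrow> vertex)" where
  "limit_ray X = (\<lambda>n. THE v. length v = n \<and> (\<forall>\<^sub>F k in sequentially. take n (X k) = v))"

lemma measurable_limit_ray: "limit_ray \<in> measurable (biased_walk lam T x) (\<Pi>\<^sub>M n\<in>UNIV. count_space UNIV)"
proof -
  have [measurable]: "(\<lambda>X. X k) \<in> measurable (biased_walk lam T x) (count_space UNIV)" for k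
    by (subst measurable_cong_sets[OF sets_biased_walk refl]) (rule measurable_component_singleton, simp)
  have [measurable]: "(\<lambda>X. take n (X k)) \<in> measurable (biased_walk lam T x) (count_space UNIV)" for n k
    by (rule measurable_compose[of _ _ "count_space UNIV"]) auto
  have "(\<lambda>X. limit_ray X n) \<in> measurable (biased_walk lam T x) (count_space UNIV)" for n
    unfolding limit_ray_def eventually_sequentially
  proof (rule measurable_THE[where I=UNIV])
    show "countable (UNIV :: vertex set)" by simp
    show "Measurable.pred (biased_walk lam T x) (\<lambda>X. length v = n \<and> (\<exists>N. \<forall>k\<ge>N. take n (X k) = v))" for v
      by measurable
    show "i = j" if "length i = n \<and> (\<exists>N. \<forall>k\<ge>N. take n (X k) = i)" "length j = n \<and> (\<exists>N. \<forall>k\<ge>N. take n (X k) = j)"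
      for X :: "nat \<Rightarrow> vertex" and i j
      using that by (metis nat_le_linear)
  qed auto
  then show ?thesis
    by (intro measurable_PiM_single') (auto)
qed

definition HARM :: "real \<Rightarrow> vertex set \<Rightarrow> (nat \<Rightarrow> vertex) measure" where
  "HARM lam T = distr (biased_walk lam T []) (\<Pi>\<^sub>M n\<in>UNIV. count_space UNIV) limit_ray"

lemma prob_space_HARM: "prob_space (HARM lam T)"
  unfolding HARM_def by (intro prob_space.prob_space_distr prob_space_biased_walk measurable_limit_ray)

end

theory Submission
  imports Defs
begin

text \<open>
  Off the path to a vertex \<open>x\<close>, a subtree with conductance \<open>b\<close> to infinity lets the walk escape, and this
  bounds the harmonic measure of the rays through \<open>x\<close> by a product of hitting probabilities of successive
  vertices. The product is at most the product of \<open>1 / (1 + R k)\<close> and, up to a constant, at most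
  \<open>lam\<close> to the power \<open>- length x\<close> times the product of \<open>lam / (lam + R k)\<close>, where \<open>R k\<close> is the
  conductance of the subtrees branching off at the \<open>k\<close>-th vertex. So it suffices that along every
  ray \<open>R k\<close> is bounded away from \<open>0\<close> for a positive fraction of the \<open>k\<close>.

  The conductance of a subtree dominates a multiple of the survival probability of percolation with
  retention \<open>1 / L\<close>, \<open>max 1 lam < L < m\<close>, which is positive because the percolation cluster is a
  supercritical Galton--Watson tree. Hence the expected number of vertices of generation \<open>n\<close> whose
  path has few branchings into well-conducting subtrees is about \<open>p\<^sub>1 ^ n\<close>, and by Borel--Cantelli
  there are finally none. Existence of the limit ray is read off from the dimension hypothesis: if
  rays did not have full measure, the infimum defining the dimension would be over the empty set.
\<close>

subsection \<open>The branching property\<close>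

text \<open>The offspring field seen from \<open>u\<close>. It is defined for every
  \<open>u\<close>, in the tree or not, so that almost sure statements can be transported to all
  countably many vertices at once.\<close>

definition shift :: "vertex \<Rightarrow> (vertex \<Rightarrow> nat) \<Rightarrow> vertex \<Rightarrow> nat" where
  "shift u \<nu> w = \<nu> (u @ w)"

lemma shift_Nil [simp]: "shift [] \<nu> = \<nu>"
  by (simp add: shift_def fun_eq_iff)

lemma shift_shift [simp]: "shift v (shift u \<nu>) = shift (u @ v) \<nu>"
  by (simp add: shift_def fun_eq_iff)

lemma shift_root [simp]: "shift u \<nu> [] = \<nu> u"
  by (simp add: shift_def)

lemma space_gw_offspring [simp]: "space (gw_offspring p) = UNIV"
  by (simp add: gw_offspring_def space_PiM)

lemma sets_gw_offspring: "sets (gw_offspring p) = sets (\<Pi>\<^sub>M u\<in>UNIV. count_space UNIV)"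
  unfolding gw_offspring_def by (intro sets_PiM_cong) auto

lemma prob_space_gw_offspring: "prob_space (gw_offspring p)"
  unfolding gw_offspring_def by (intro prob_space_PiM measure_pmf.prob_space_axioms)

lemma measurable_root [measurable]: "(\<lambda>\<nu>. \<nu> u) \<in> measurable (gw_offspring p) (count_space UNIV)"
  by (subst measurable_cong_sets[OF sets_gw_offspring refl]) simp

lemma measurable_shift [measurable]: "shift u \<in> measurable (gw_offspring p) (gw_offspring p)"
proof -
  have "(\<lambda>\<nu> w. \<nu> (u @ w)) \<in> measurable (gw_offspring p) (\<Pi>\<^sub>M u\<in>UNIV. measure_pmf p)"
    by (intro measurable_PiM_single') (auto simp: space_PiM)
  then show ?thesis by (simp add: gw_offspring_def shift_def[abs_def])
qed

text \<open>The map sending \<open>w\<close> to \<open>u @ w\<close> is injective, so the shifted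
  field again consists of independent offspring numbers with law \<open>p\<close>.\<close>

lemma distr_shift: "distr (gw_offspring p) (gw_offspring p) (shift u) = gw_offspring p"
  using distr_PiM_reindex[of UNIV "\<lambda>_. measure_pmf p" "\<lambda>w. u @ w" UNIV]
  by (simp add: gw_offspring_def shift_def[abs_def] measure_pmf.prob_space_axioms inj_on_def restrict_UNIV)

lemma AE_shift:
  assumes "AE \<nu> in gw_offspring p. P \<nu>"
  shows "AE \<nu> in gw_offspring p. \<forall>u. P (shift u \<nu>)"
  unfolding AE_all_countable
  by (intro allI AE_distrD[OF measurable_shift]) (use assms in \<open>simp only: distr_shift\<close>)

lemma nn_integral_shift:
  assumes "f \<in> borel_measurable (gw_offspring p)"
  shows "(\<integral>\<^sup>+\<nu>. f (shift u \<nu>) \<partial>gw_offspring p) = (\<integral>\<^sup>+\<nu>. f \<nu> \<partial>gw_offspring p)"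
  using nn_integral_distr[OF measurable_shift[of u p], of f] assms by (simp add: distr_shift)

lemma AE_offspring:
  assumes "AE k in measure_pmf p. P k"
  shows "AE \<nu> in gw_offspring p. \<forall>u. P (\<nu> u)"
  unfolding AE_all_countable gw_offspring_def
  by (intro allI AE_PiM_component measure_pmf.prob_space_axioms assms UNIV_I)

lemma indep_vars_offspring:
  "prob_space.indep_vars (gw_offspring p) (\<lambda>_. measure_pmf p) (\<lambda>u \<nu>. \<nu> u) UNIV"
proof -
  interpret prob_space "gw_offspring p" by (rule prob_space_gw_offspring)
  have "distr (gw_offspring p) (measure_pmf p) (\<lambda>\<nu>. \<nu> u) = measure_pmf p" for u
    unfolding gw_offspring_def by (intro distr_PiM_component measure_pmf.prob_space_axioms UNIV_I)
  moreover have "distr (gw_offspring p) (gw_offspring p) (\<lambda>x. x) = gw_offspring p"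
    by (rule distr_id)
  ultimately show ?thesis
    by (subst indep_vars_iff_distr_eq_PiM) (auto simp: restrict_UNIV gw_offspring_def[symmetric])
qed

text \<open>The branching property on the event of \<open>k\<close> children: the offspring number
  of the root and the fields seen from its children depend on disjoint sets of coordinates, hence
  are independent.\<close>

lemma nn_integral_branching_fixed:
  fixes f :: "nat \<Rightarrow> (vertex \<Rightarrow> nat) \<Rightarrow> ennreal"
  assumes f: "\<And>i. i < k \<Longrightarrow> f i \<in> borel_measurable (gw_offspring p)"
  shows "(\<integral>\<^sup>+\<nu>. indicator {k} (\<nu> []) * (\<Prod>i<k. f i (shift [i] \<nu>)) \<partial>gw_offspring p) =
    ennreal (pmf p k) * (\<Prod>i<k. \<integral>\<^sup>+\<nu>. f i \<nu> \<partial>gw_offspring p)"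
proof -
  interpret prob_space "gw_offspring p" by (rule prob_space_gw_offspring)
  let ?G = "gw_offspring p"
  \<comment> \<open>Block \<open>0\<close> holds the root and block \<open>Suc i\<close> everything
    below its \<open>i\<close>-th child, so the index of a child is shifted by one.\<close>
  define L :: "nat \<Rightarrow> vertex set" where "L j = (case j of 0 \<Rightarrow> {[]} | Suc i \<Rightarrow> range ((#) i))" for j
  define Y :: "nat \<Rightarrow> (vertex \<Rightarrow> nat) \<Rightarrow> ennreal" where
    "Y j = (case j of 0 \<Rightarrow> (\<lambda>\<nu>. indicator {k} (\<nu> [])) | Suc i \<Rightarrow> (\<lambda>\<nu>. f i (shift [i] \<nu>)))" for j
  have "disjoint_family_on L {..k}"
    by (auto simp: disjoint_family_on_def L_def split: nat.splits)
  from indep_vars_restrict[OF indep_vars_offspring _ this]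
  have "indep_vars (\<lambda>j. PiM (L j) (\<lambda>_. measure_pmf p)) (\<lambda>j \<nu>. restrict \<nu> (L j)) {..k}"
    by simp
  moreover have "Y j \<in> borel_measurable (PiM (L j) (\<lambda>_. measure_pmf p))" if "j \<in> {..k}" for j
  proof (cases j)
    case 0
    have "(\<lambda>\<nu>. \<nu> []) \<in> measurable (PiM (L j) (\<lambda>_. measure_pmf p)) (measure_pmf p)"
      by (intro measurable_component_singleton) (auto simp: L_def 0)
    from measurable_compose[OF this, of "indicator {k}" borel] show ?thesis by (simp add: Y_def 0)
  next
    case (Suc i)
    have "shift [i] \<in> measurable (PiM (L j) (\<lambda>_. measure_pmf p)) ?G"
      unfolding gw_offspring_def shift_def[abs_def]
      by (intro measurable_PiM_single' measurable_component_singleton) (auto simp: L_def Suc space_PiM)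
    from measurable_compose[OF this f] show ?thesis using that by (simp add: Y_def Suc)
  qed
  ultimately have "indep_vars (\<lambda>_. borel) (\<lambda>j \<nu>. Y j (restrict \<nu> (L j))) {..k}"
    by (rule indep_vars_compose2)
  \<comment> \<open>\<open>Y j\<close> reads coordinates in \<open>L j\<close> only, so it does not
    notice the restriction.\<close>
  moreover have "(\<lambda>j \<nu>. Y j (restrict \<nu> (L j))) = Y"
    by (intro ext) (auto simp: Y_def L_def shift_def[abs_def] split: nat.splits)
  ultimately have "indep_vars (\<lambda>_. borel) Y {..k}" by simp
  then have "(\<integral>\<^sup>+\<nu>. (\<Prod>j\<in>{..k}. Y j \<nu>) \<partial>?G) = (\<Prod>j\<in>{..k}. \<integral>\<^sup>+\<nu>. Y j \<nu> \<partial>?G)"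
    by (intro indep_vars_nn_integral) auto
  moreover have "(\<integral>\<^sup>+\<nu>. indicator {k} (\<nu> []) \<partial>?G) = ennreal (pmf p k)"
  proof -
    have "(\<integral>\<^sup>+\<nu>. indicator {k} (\<nu> []) \<partial>?G) = (\<integral>\<^sup>+i. indicator {k} i \<partial>distr ?G (measure_pmf p) (\<lambda>\<nu>. \<nu> []))"
      by (subst nn_integral_distr) auto
    also have "distr ?G (measure_pmf p) (\<lambda>\<nu>. \<nu> []) = measure_pmf p"
      unfolding gw_offspring_def by (intro distr_PiM_component measure_pmf.prob_space_axioms UNIV_I)
    finally show ?thesis by (simp add: emeasure_pmf_single)
  qed
  moreover have "{..k} = {..<Suc k}" by auto
  ultimately show ?thesis
    unfolding \<open>{..k} = {..<Suc k}\<close> prod.lessThan_Suc_shift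
    by (simp add: Y_def nn_integral_shift f)
qed

text \<open>Sums the fixed version over the values of \<open>\<nu> []\<close>. The index
  \<open>a\<close> lets one child be marked, which sums over paths require; a one-element
  \<open>A k\<close> gives the plain product over the children.\<close>

lemma nn_integral_branching:
  fixes f :: "nat \<Rightarrow> 'a \<Rightarrow> nat \<Rightarrow> (vertex \<Rightarrow> nat) \<Rightarrow> ennreal"
  assumes f [measurable]: "\<And>k a i. f k a i \<in> borel_measurable (gw_offspring p)"
  shows "(\<integral>\<^sup>+\<nu>. (\<Sum>a\<in>A (\<nu> []). \<Prod>i<\<nu> []. f (\<nu> []) a i (shift [i] \<nu>)) \<partial>gw_offspring p) =
    (\<integral>\<^sup>+k. (\<Sum>a\<in>A k. \<Prod>i<k. \<integral>\<^sup>+\<nu>. f k a i \<nu> \<partial>gw_offspring p) \<partial>measure_pmf p)"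
proof -
  let ?G = "gw_offspring p"
  have [measurable]: "(\<lambda>\<nu>. f k a i (shift [i] \<nu>)) \<in> borel_measurable ?G" for k a i
    by (rule measurable_compose[OF measurable_shift f])
  have [measurable]: "(\<lambda>\<nu>. indicator {k} (\<nu> []) :: ennreal) \<in> borel_measurable ?G" for k
    by (rule measurable_compose[OF measurable_root]) simp
  have "(\<integral>\<^sup>+\<nu>. (\<Sum>a\<in>A (\<nu> []). \<Prod>i<\<nu> []. f (\<nu> []) a i (shift [i] \<nu>)) \<partial>?G) =
    (\<integral>\<^sup>+\<nu>. (\<Sum>k. \<Sum>a\<in>A k. indicator {k} (\<nu> []) * (\<Prod>i<k. f k a i (shift [i] \<nu>))) \<partial>?G)"
  proof (intro nn_integral_cong)
    fix \<nu> :: "vertex \<Rightarrow> nat"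
    have "(\<Sum>k. \<Sum>a\<in>A k. indicator {k} (\<nu> []) * (\<Prod>i<k. f k a i (shift [i] \<nu>))) =
      (\<Sum>k\<in>{\<nu> []}. \<Sum>a\<in>A k. indicator {k} (\<nu> []) * (\<Prod>i<k. f k a i (shift [i] \<nu>)))"
      by (intro suminf_finite) auto
    then show "(\<Sum>a\<in>A (\<nu> []). \<Prod>i<\<nu> []. f (\<nu> []) a i (shift [i] \<nu>)) =
      (\<Sum>k. \<Sum>a\<in>A k. indicator {k} (\<nu> []) * (\<Prod>i<k. f k a i (shift [i] \<nu>)))"
      by simp
  qed
  also have "\<dots> = (\<Sum>k. \<Sum>a\<in>A k. \<integral>\<^sup>+\<nu>. indicator {k} (\<nu> []) * (\<Prod>i<k. f k a i (shift [i] \<nu>)) \<partial>?G)"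
    by (simp add: nn_integral_suminf nn_integral_sum)
  also have "\<dots> = (\<Sum>k. ennreal (pmf p k) * (\<Sum>a\<in>A k. \<Prod>i<k. \<integral>\<^sup>+\<nu>. f k a i \<nu> \<partial>?G))"
    by (simp add: nn_integral_branching_fixed sum_distrib_left)
  also have "\<dots> = (\<integral>\<^sup>+k. (\<Sum>a\<in>A k. \<Prod>i<k. \<integral>\<^sup>+\<nu>. f k a i \<nu> \<partial>?G) \<partial>measure_pmf p)"
    by (simp add: nn_integral_measure_pmf nn_integral_count_space_nat)
  finally show ?thesis .
qed

subsection \<open>Percolation on the tree\<close>

text \<open>
  \<open>perc_ext L n \<nu>\<close> is the conditional probability, given the tree, that percolation with retention
  probability \<open>1 / L\<close> on the edges does not connect the root to generation \<open>n\<close>.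
\<close>

primrec perc_ext :: "real \<Rightarrow> nat \<Rightarrow> (vertex \<Rightarrow> nat) \<Rightarrow> real" where
  "perc_ext L 0 \<nu> = 0"
| "perc_ext L (Suc n) \<nu> = (\<Prod>i<\<nu> []. 1 - (1 - perc_ext L n (shift [i] \<nu>)) / L)"

definition perc_surv :: "real \<Rightarrow> (vertex \<Rightarrow> nat) \<Rightarrow> real" where
  "perc_surv L \<nu> = 1 - lim (\<lambda>n. perc_ext L n \<nu>)"

lemma perc_factor_bounds:
  fixes L e :: real
  assumes "1 \<le> L" "0 \<le> e" "e \<le> 1"
  shows "0 \<le> 1 - (1 - e) / L" "1 - (1 - e) / L \<le> 1"
  using assms by (auto simp: field_simps)

lemma perc_ext_bounds:
  assumes "1 \<le> L"
  shows "0 \<le> perc_ext L n \<nu> \<and> perc_ext L n \<nu> \<le> 1"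
proof (induction n arbitrary: \<nu>)
  case (Suc n)
  show ?case
    unfolding perc_ext.simps using Suc assms
    by (intro conjI prod_nonneg prod_le_1 ballI perc_factor_bounds) auto
qed simp

lemma perc_ext_Suc_le:
  assumes "1 \<le> L"
  shows "perc_ext L n \<nu> \<le> perc_ext L (Suc n) \<nu>"
proof (induction n arbitrary: \<nu>)
  case 0
  show ?case using perc_ext_bounds[OF assms, of "Suc 0" \<nu>] by simp
next
  case (Suc n)
  have "(\<Prod>i<\<nu> []. 1 - (1 - perc_ext L n (shift [i] \<nu>)) / L) \<le>
    (\<Prod>i<\<nu> []. 1 - (1 - perc_ext L (Suc n) (shift [i] \<nu>)) / L)"
    using assms perc_ext_bounds[OF assms]
    by (intro prod_mono conjI diff_left_mono divide_right_mono perc_factor_bounds(1) Suc)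
      (auto simp del: perc_ext.simps)
  then show ?case by (simp only: perc_ext.simps(2))
qed

lemma perc_ext_tendsto:
  assumes "1 \<le> L"
  shows "(\<lambda>n. perc_ext L n \<nu>) \<longlonglongrightarrow> 1 - perc_surv L \<nu>"
proof -
  have "incseq (\<lambda>n. perc_ext L n \<nu>)"
    by (intro incseq_SucI perc_ext_Suc_le assms)
  then obtain l where "(\<lambda>n. perc_ext L n \<nu>) \<longlonglongrightarrow> l"
    using perc_ext_bounds[OF assms] incseq_convergent[of "\<lambda>n. perc_ext L n \<nu>" 1] by blast
  then show ?thesis by (simp add: perc_surv_def limI)
qed

lemma perc_surv_bounds:
  assumes "1 \<le> L"
  shows "0 \<le> perc_surv L \<nu>" "perc_surv L \<nu> \<le> 1"
  using LIMSEQ_le_const2[OF perc_ext_tendsto[OF assms, of \<nu>], of 1]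
    LIMSEQ_le_const[OF perc_ext_tendsto[OF assms, of \<nu>], of 0] perc_ext_bounds[OF assms, of _ \<nu>]
  by auto

lemma perc_surv_rec:
  assumes "1 \<le> L"
  shows "1 - perc_surv L \<nu> = (\<Prod>i<\<nu> []. 1 - perc_surv L (shift [i] \<nu>) / L)"
proof -
  have "(\<lambda>n. perc_ext L (Suc n) \<nu>) \<longlonglongrightarrow> (\<Prod>i<\<nu> []. 1 - (1 - (1 - perc_surv L (shift [i] \<nu>))) / L)"
    unfolding perc_ext.simps using assms
    by (intro tendsto_prod tendsto_intros perc_ext_tendsto) auto
  moreover have "(\<lambda>n. perc_ext L (Suc n) \<nu>) \<longlonglongrightarrow> 1 - perc_surv L \<nu>"
    by (rule LIMSEQ_Suc[OF perc_ext_tendsto[OF assms]])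
  ultimately show ?thesis using LIMSEQ_unique by auto
qed

lemma measurable_perc_ext [measurable]: "perc_ext L n \<in> borel_measurable (gw_offspring p)"
proof (induction n)
  case (Suc n)
  note [measurable] = Suc measurable_compose[OF measurable_shift Suc]
  have "(\<lambda>\<nu>. (\<lambda>k \<nu>. \<Prod>i<k. 1 - (1 - perc_ext L n (shift [i] \<nu>)) / L) (\<nu> []) \<nu>)
      \<in> borel_measurable (gw_offspring p)"
    by (rule measurable_compose_countable) measurable
  then show ?case by simp
qed simp

lemma measurable_perc_surv [measurable]: "perc_surv L \<in> borel_measurable (gw_offspring p)"
  unfolding perc_surv_def[abs_def] by measurable

text \<open>
  The conductance \<open>b\<close> from the root to infinity satisfies \<open>b = S / (lam + S)\<close>, where \<open>S\<close> is the sum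
  over the children; a multiple of the survival probability is a subsolution.
\<close>

lemma perc_surv_subsolution:
  assumes "1 \<le> L" "0 < lam" "lam < L"
  defines "c \<equiv> 1 - lam / L"
  shows "lam \<le> (1 - c * perc_surv L \<nu>) * (lam + (\<Sum>i<\<nu> []. c * perc_surv L (shift [i] \<nu>)))"
proof -
  define S where "S = (\<Sum>i<\<nu> []. perc_surv L (shift [i] \<nu>))"
  define s where "s = perc_surv L \<nu>"
  have c: "0 < c" "c * L = L - lam" using assms by (auto simp: c_def field_simps)
  have s: "0 \<le> s" "s \<le> 1" using perc_surv_bounds[OF assms(1)] by (auto simp: s_def)
  have S0: "0 \<le> S" unfolding S_def by (intro sum_nonneg perc_surv_bounds assms)
  \<comment> \<open>A union bound over the children: the cluster survives only through an open edge
    to a surviving child.\<close>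
  have "1 - (\<Sum>i<\<nu> []. perc_surv L (shift [i] \<nu>) / L) \<le> 1 - s"
    unfolding s_def perc_surv_rec[OF assms(1), of \<nu>]
    using perc_surv_bounds[OF assms(1)] assms(1)
    by (intro Weierstrass_prod_ineq) (auto simp: divide_le_eq intro: order_trans)
  then have sS: "s * L \<le> S"
    using assms by (simp add: S_def sum_divide_distrib[symmetric] field_simps)
  \<comment> \<open>Multiplied by \<open>c\<close>, this is the claim rearranged. For
    \<open>L \<le> S\<close> it follows from \<open>s \<le> 1\<close>, otherwise from
    \<open>s * L \<le> S\<close>, because \<open>c\<close> is chosen so that
    \<open>lam + c * L = L\<close>.\<close>
  have "s * (lam + c * S) \<le> S"
  proof (cases "L \<le> S")
    case True
    have "s * (lam + c * S) \<le> 1 * (lam + c * S)"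
      using s c S0 assms by (intro mult_right_mono) auto
    also have "\<dots> = S + lam * (1 - S / L)" using assms by (simp add: c_def field_simps)
    also have "\<dots> \<le> S" using True assms by (simp add: mult_le_0_iff field_simps)
    finally show ?thesis .
  next
    case False
    have "s * (lam + c * S) \<le> s * (lam + c * L)"
      using False s c by (intro mult_left_mono add_left_mono) auto
    also have "\<dots> = s * L" using c by simp
    finally show ?thesis using sS by simp
  qed
  then have "c * (s * (lam + c * S)) \<le> c * S" using c by (intro mult_left_mono) auto
  then show ?thesis
    by (simp add: S_def[symmetric] s_def[symmetric] sum_distrib_left[symmetric] algebra_simps)
qed

text \<open>The mean is the left derivative at \<open>1\<close> of the generating function, so a
  slope \<open>L\<close> below the mean leaves room for such a bound near \<open>1\<close>. The
  derivative is obtained by dominated convergence of the difference quotients \<open>f n k\<close>,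
  which lie between \<open>0\<close> and \<open>k\<close>.\<close>

lemma exists_generating_function_small:
  fixes p :: "nat pmf"
  assumes int: "integrable (measure_pmf p) real" and L: "0 < L" "L < measure_pmf.expectation p real"
  shows "\<exists>t>0. t * L \<le> 1 \<and> t \<le> 1 \<and> measure_pmf.expectation p (\<lambda>k. (1 - t) ^ k) \<le> 1 - L * t"
proof -
  define u where "u n = inverse (real (Suc n))" for n
  have u: "0 < u n" "u n \<le> 1" for n by (auto simp: u_def field_simps)
  have u0: "u \<longlonglongrightarrow> 0" unfolding u_def by (rule LIMSEQ_inverse_real_of_nat)
  define f where "f n k = (\<Sum>j<k. (1 - u n) ^ j)" for n k
  have f: "1 - (1 - u n) ^ k = u n * f n k" for n k
    using one_diff_power_eq[of "1 - u n" k] by (simp add: f_def)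
  have f1: "\<bar>f n k\<bar> \<le> real k" for n k
  proof -
    have "f n k \<le> (\<Sum>j<k. 1)" unfolding f_def using u[of n] by (intro sum_mono power_le_one) auto
    moreover have "0 \<le> f n k" unfolding f_def using u[of n] by (intro sum_nonneg) auto
    ultimately show ?thesis by simp
  qed
  have "(\<lambda>n. measure_pmf.expectation p (f n)) \<longlonglongrightarrow> measure_pmf.expectation p real"
  proof (rule integral_dominated_convergence[where w=real])
    have "(\<lambda>n. f n k) \<longlonglongrightarrow> (\<Sum>j<k. (1 - 0) ^ j)" for k
      unfolding f_def by (intro tendsto_intros u0)
    then show "AE k in measure_pmf p. (\<lambda>n. f n k) \<longlonglongrightarrow> real k" by simp
  qed (use int f1 in auto)
  moreover have "(\<lambda>n. u n * L) \<longlonglongrightarrow> 0 * L" by (intro tendsto_intros u0)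
  ultimately have "\<forall>\<^sub>F n in sequentially. L < measure_pmf.expectation p (f n) \<and> u n * L < 1"
    using order_tendstoD L(2) by (intro eventually_conj) fastforce+
  then obtain n where n: "L < measure_pmf.expectation p (f n)" "u n * L < 1"
    by (auto simp: eventually_sequentially)
  have intf: "integrable (measure_pmf p) (f n)"
    using int f1 by (intro Bochner_Integration.integrable_bound[OF int]) auto
  have "(1 - u n) ^ k = 1 - u n * f n k" for k using f[of n k] by simp
  then have "measure_pmf.expectation p (\<lambda>k. (1 - u n) ^ k) = 1 - u n * measure_pmf.expectation p (f n)"
    using intf by (simp add: Bochner_Integration.integral_diff)
  also have "\<dots> \<le> 1 - L * u n" using n u[of n] by simp
  finally show ?thesis using n u[of n] by (intro exI[of _ "u n"]) auto
qed

text \<open>The value \<open>1 - L * t\<close> is a barrier for the mean extinction probability.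
  Below it, the probability \<open>y\<close> that a child is cut off or has a dying cluster has mean
  at most \<open>1 - t\<close>, and the generating function at \<open>1 - t\<close> leads back below
  the barrier.\<close>

lemma nn_integral_perc_ext_le:
  assumes L: "1 \<le> L" and t: "0 < t" "t * L \<le> 1" "t \<le> 1"
    and G: "measure_pmf.expectation p (\<lambda>k. (1 - t) ^ k) \<le> 1 - L * t"
  shows "(\<integral>\<^sup>+\<nu>. ennreal (perc_ext L n \<nu>) \<partial>gw_offspring p) \<le> ennreal (1 - L * t)"
proof (induction n)
  case (Suc n)
  interpret prob_space "gw_offspring p" by (rule prob_space_gw_offspring)
  let ?G = "gw_offspring p"
  define y where "y \<nu> = ennreal (1 - (1 - perc_ext L n \<nu>) / L)" for \<nu>
  have [measurable]: "y \<in> borel_measurable ?G" unfolding y_def[abs_def] by measurable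
  have eq: "1 - (1 - e) / L = 1 - 1 / L + e / L" for e
    by (simp add: diff_divide_distrib)
  have "(\<integral>\<^sup>+\<nu>. y \<nu> \<partial>?G) = (\<integral>\<^sup>+\<nu>. ennreal (1 - 1 / L) + ennreal (1 / L) * ennreal (perc_ext L n \<nu>) \<partial>?G)"
    using L perc_ext_bounds[OF L]
    by (intro nn_integral_cong)
      (simp add: y_def eq ennreal_mult'[symmetric] ennreal_plus[symmetric] del: ennreal_plus)
  also have "\<dots> = ennreal (1 - 1 / L) + ennreal (1 / L) * (\<integral>\<^sup>+\<nu>. ennreal (perc_ext L n \<nu>) \<partial>?G)"
    by (simp add: nn_integral_add nn_integral_cmult emeasure_space_1[simplified])
  also have "\<dots> \<le> ennreal (1 - 1 / L) + ennreal (1 / L) * ennreal (1 - L * t)"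
    by (intro add_left_mono mult_left_mono Suc) auto
  also have "\<dots> = ennreal (1 - 1 / L + 1 / L * (1 - L * t))"
    using L t by (simp add: ennreal_mult'[symmetric] ennreal_plus[symmetric] mult.commute[of t] del: ennreal_plus)
  also have "1 - 1 / L + 1 / L * (1 - L * t) = 1 - t"
    using L by (simp add: right_diff_distrib)
  finally have y: "(\<integral>\<^sup>+\<nu>. y \<nu> \<partial>?G) \<le> ennreal (1 - t)" .
  have "(\<integral>\<^sup>+\<nu>. ennreal (perc_ext L (Suc n) \<nu>) \<partial>?G) = (\<integral>\<^sup>+\<nu>. (\<Sum>a\<in>{()}. \<Prod>i<\<nu> []. y (shift [i] \<nu>)) \<partial>?G)"
    unfolding y_def
    by (intro nn_integral_cong)
      (simp, intro prod_ennreal[symmetric] perc_factor_bounds(1) L, simp_all add: perc_ext_bounds L)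
  also have "\<dots> = (\<integral>\<^sup>+k. (\<integral>\<^sup>+\<nu>. y \<nu> \<partial>?G) ^ k \<partial>measure_pmf p)"
    by (subst nn_integral_branching) simp_all
  also have "\<dots> \<le> (\<integral>\<^sup>+k. ennreal ((1 - t) ^ k) \<partial>measure_pmf p)"
    using y t by (intro nn_integral_mono) (simp add: ennreal_power[symmetric] power_mono)
  also have "\<dots> = ennreal (measure_pmf.expectation p (\<lambda>k. (1 - t) ^ k))"
    using t by (intro nn_integral_eq_integral measure_pmf.integrable_const_bound[where B=1])
      (auto intro!: power_le_one)
  also have "\<dots> \<le> ennreal (1 - L * t)" using G by (rule ennreal_leI)
  finally show ?case .
qed simp

text \<open>The survival probability vanishes at the root exactly if it vanishes at all children, so
  the probability \<open>q\<close> of this event is a fixed point of the offspring generating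
  function. As there are no leaves and \<open>pmf p 1 < 1\<close>, the only fixed points in the unit
  interval are \<open>0\<close> and \<open>1\<close>, and the barrier excludes
  \<open>1\<close>.\<close>

lemma AE_perc_surv_pos:
  assumes p: "pmf p 0 = 0" "pmf p 1 \<noteq> 1" and int: "integrable (measure_pmf p) real"
    and L: "1 \<le> L" "L < measure_pmf.expectation p real"
  shows "AE \<nu> in gw_offspring p. 0 < perc_surv L \<nu>"
proof -
  interpret prob_space "gw_offspring p" by (rule prob_space_gw_offspring)
  let ?G = "gw_offspring p"
  obtain t where t: "0 < t" "t * L \<le> 1" "t \<le> 1" "measure_pmf.expectation p (\<lambda>k. (1 - t) ^ k) \<le> 1 - L * t"
    using exists_generating_function_small[OF int, of L] L by auto
  define Q where "Q = {\<nu>. perc_surv L \<nu> = 0}"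
  have [measurable]: "Q \<in> sets ?G"
  proof -
    have "{\<nu> \<in> space ?G. perc_surv L \<nu> = 0} \<in> sets ?G" by measurable
    then show ?thesis by (simp add: Q_def)
  qed
  define q where "q = prob Q"
  have q01: "0 \<le> q" "q \<le> 1" by (auto simp: q_def)
  have "(\<lambda>n. \<integral>\<^sup>+\<nu>. ennreal (perc_ext L n \<nu>) \<partial>?G) \<longlonglongrightarrow> (\<integral>\<^sup>+\<nu>. ennreal (1 - perc_surv L \<nu>) \<partial>?G)"
    using perc_ext_Suc_le[OF L(1)] perc_ext_tendsto[OF L(1)]
    by (intro nn_integral_LIMSEQ) (auto intro!: incseq_SucI le_funI ennreal_leI tendsto_ennrealI)
  then have le: "(\<integral>\<^sup>+\<nu>. ennreal (1 - perc_surv L \<nu>) \<partial>?G) \<le> ennreal (1 - L * t)"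
    by (rule LIMSEQ_le_const2) (use nn_integral_perc_ext_le[OF L(1) t] in auto)
  \<comment> \<open>On \<open>Q\<close> extinction is certain, so \<open>q\<close> is at most the
    mean extinction probability.\<close>
  have "ennreal q = (\<integral>\<^sup>+\<nu>. indicator Q \<nu> \<partial>?G)" by (simp add: q_def emeasure_eq_measure)
  also have "\<dots> \<le> (\<integral>\<^sup>+\<nu>. ennreal (1 - perc_surv L \<nu>) \<partial>?G)"
    by (intro nn_integral_mono) (simp add: indicator_def Q_def)
  finally have "ennreal q \<le> ennreal (1 - L * t)" using le by simp
  then have "q \<le> 1 - L * t" using L t by (subst (asm) ennreal_le_iff) (auto simp: mult.commute)
  then have q1: "q < 1" using t L by (smt (verit) mult_pos_pos)
  have ind: "indicator Q \<nu> = (\<Prod>i<\<nu> []. indicator Q (shift [i] \<nu>) :: ennreal)" for \<nu>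
  proof (cases "\<forall>i<\<nu> []. perc_surv L (shift [i] \<nu>) = 0")
    case True
    then show ?thesis using perc_surv_rec[OF L(1), of \<nu>] by (simp add: Q_def indicator_def)
  next
    case False
    then obtain i where i: "i < \<nu> []" "perc_surv L (shift [i] \<nu>) > 0"
      using perc_surv_bounds(1)[OF L(1)] by (metis order_le_less)
    have bd: "0 \<le> 1 - perc_surv L \<mu> / L" "1 - perc_surv L \<mu> / L \<le> 1" for \<mu>
      using perc_surv_bounds[OF L(1), of \<mu>] L(1) by (auto simp: divide_le_eq)
    have "(\<Prod>i<\<nu> []. 1 - perc_surv L (shift [i] \<nu>) / L) =
      (1 - perc_surv L (shift [i] \<nu>) / L) * (\<Prod>j\<in>{..<\<nu> []} - {i}. 1 - perc_surv L (shift [j] \<nu>) / L)"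
      using i by (intro prod.remove) auto
    also have "\<dots> \<le> 1 - perc_surv L (shift [i] \<nu>) / L"
      using bd by (intro mult_left_le prod_le_1) auto
    also have "\<dots> < 1" using i L by simp
    finally have "perc_surv L \<nu> \<noteq> 0" using perc_surv_rec[OF L(1), of \<nu>] by auto
    moreover have "(\<Prod>i<\<nu> []. indicator Q (shift [i] \<nu>) :: ennreal) = 0"
      using i by (intro prod_zero bexI[of _ i]) (auto simp: Q_def)
    ultimately show ?thesis by (simp add: Q_def)
  qed
  have int2: "integrable (measure_pmf p) (\<lambda>k. (q - q\<^sup>2) * indicator {1} k)"
    by (intro integrable_mult_right integrable_real_indicator) (simp_all add: less_top[symmetric])
  have "ennreal q = (\<integral>\<^sup>+\<nu>. indicator Q \<nu> \<partial>?G)" by (simp add: q_def emeasure_eq_measure)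
  also have "\<dots> = (\<integral>\<^sup>+\<nu>. (\<Sum>a\<in>{()}. \<Prod>i<\<nu> []. indicator Q (shift [i] \<nu>)) \<partial>?G)"
    by (subst ind) simp
  also have "\<dots> = (\<integral>\<^sup>+k. ennreal (q ^ k) \<partial>measure_pmf p)"
    by (subst nn_integral_branching) (simp_all add: q_def emeasure_eq_measure ennreal_power)
  also have "\<dots> = ennreal (measure_pmf.expectation p (\<lambda>k. q ^ k))"
    using q01 by (intro nn_integral_eq_integral measure_pmf.integrable_const_bound[where B=1])
      (auto intro!: power_le_one)
  finally have "q = measure_pmf.expectation p (\<lambda>k. q ^ k)"
    using q01 by (simp add: Bochner_Integration.integral_nonneg)
  \<comment> \<open>Only \<open>k = 1\<close> contributes \<open>q\<close> itself;
    \<open>k = 0\<close> has probability zero and larger \<open>k\<close> contribute at most the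
    square of \<open>q\<close>.\<close>
  also have "\<dots> \<le> measure_pmf.expectation p (\<lambda>k. q\<^sup>2 + (q - q\<^sup>2) * indicator {1} k)"
  proof (rule integral_mono_AE)
    show "integrable (measure_pmf p) (\<lambda>k. q ^ k)"
      using q01 by (intro measure_pmf.integrable_const_bound[where B=1]) (auto intro!: power_le_one)
    have "k \<noteq> 0" if "k \<in> set_pmf p" for k using that p(1) by (metis set_pmf_iff)
    then show "AE k in measure_pmf p. q ^ k \<le> q\<^sup>2 + (q - q\<^sup>2) * indicator {1} k"
      using q01 by (auto simp: AE_measure_pmf_iff indicator_def Suc_le_eq nat_neq_iff intro!: power_decreasing)
  qed (use int2 in simp)
  also have "\<dots> = q\<^sup>2 + (q - q\<^sup>2) * pmf p 1"
    using int2 by (subst Bochner_Integration.integral_add) (simp_all add: measure_pmf_single)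
  finally have "(q - q\<^sup>2) * (1 - pmf p 1) \<le> 0" by (simp add: algebra_simps)
  moreover have "1 - pmf p 1 > 0" using p(2) pmf_le_1[of p 1] by simp
  ultimately have "q - q\<^sup>2 \<le> 0" unfolding mult_le_0_iff by linarith
  then have "q * (1 - q) \<le> 0" by (simp add: power2_eq_square algebra_simps)
  then have "q = 0" using q01 q1 by (auto simp: mult_le_0_iff)
  then have "AE \<nu> in ?G. \<nu> \<notin> Q"
    by (intro AE_not_in) (simp add: null_sets_def q_def emeasure_eq_measure)
  then show ?thesis
    by eventually_elim (use perc_surv_bounds(1)[OF L(1)] in \<open>auto simp: Q_def order_le_less\<close>)
qed

subsection \<open>Paths of the biased walk and limit rays\<close>

primrec path_pmf :: "('a \<Rightarrow> 'a pmf) \<Rightarrow> nat \<Rightarrow> 'a \<Rightarrow> 'a list pmf" where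
  "path_pmf K 0 u = return_pmf [u]"
| "path_pmf K (Suc n) u = K u \<bind> (\<lambda>v. map_pmf ((#) u) (path_pmf K n v))"

lemma length_path_pmf: "xs \<in> set_pmf (path_pmf K n u) \<Longrightarrow> length xs = Suc n"
  by (induction n arbitrary: u xs) auto

lemma pmf_path_pmf:
  assumes "length xs = Suc n"
  shows "pmf (path_pmf K n u) xs =
    (if xs ! 0 = u then \<Prod>i<n. pmf (K (xs ! i)) (xs ! Suc i) else 0)"
  using assms
proof (induction n arbitrary: u xs)
  case 0
  then show ?case by (cases xs) (auto simp: pmf_return)
next
  case (Suc n)
  then obtain x ys where xs: "xs = x # ys" "length ys = Suc n" by (cases xs) auto
  show ?case
  proof (cases "x = u")
    case True
    have "pmf (path_pmf K (Suc n) u) xs = (\<integral>v. pmf (path_pmf K n v) ys \<partial>K u)"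
      unfolding path_pmf.simps pmf_bind xs True by (simp add: pmf_map_inj')
    also have "\<dots> = (\<integral>v. (\<Prod>i<n. pmf (K (ys ! i)) (ys ! Suc i)) * indicator {ys ! 0} v \<partial>K u)"
      by (intro Bochner_Integration.integral_cong) (auto simp: Suc.IH[OF xs(2)] indicator_def)
    also have "\<dots> = (\<Prod>i<n. pmf (K (ys ! i)) (ys ! Suc i)) * pmf (K u) (ys ! 0)"
      by (simp add: measure_pmf_single)
    finally show ?thesis
      unfolding xs True prod.lessThan_Suc_shift by (simp add: mult.commute)
  next
    case False
    then have "pmf (map_pmf ((#) u) (path_pmf K n v)) xs = 0" for v
      by (intro pmf_map_outside) (auto simp: xs)
    then show ?thesis using False by (simp add: pmf_bind xs)
  qed
qed

text \<open>A maximum principle: a function that is superharmonic off \<open>S\<close> and at least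
  \<open>1\<close> on \<open>S\<close> dominates the hitting probability within \<open>n\<close>
  steps, by induction on the first step. The set \<open>V\<close> confines the requirement to the
  region that the chain can visit before hitting \<open>S\<close>.\<close>

lemma emeasure_path_pmf_hit_le:
  fixes g :: "'a \<Rightarrow> ennreal"
  assumes "\<And>u. u \<in> S \<Longrightarrow> 1 \<le> g u"
    and "\<And>u. u \<in> V - S \<Longrightarrow> set_pmf (K u) \<subseteq> V"
    and "\<And>u. u \<in> V - S \<Longrightarrow> (\<integral>\<^sup>+v. g v \<partial>measure_pmf (K u)) \<le> g u"
    and "u \<in> V"
  shows "emeasure (measure_pmf (path_pmf K n u)) {xs. set xs \<inter> S \<noteq> {}} \<le> g u"
  using assms(4)
proof (induction n arbitrary: u)
  case 0
  then show ?case using assms(1)[of u] by (cases "u \<in> S") (auto simp: indicator_def)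
next
  case (Suc n)
  show ?case
  proof (cases "u \<in> S")
    case True
    then show ?thesis using assms(1)[of u] measure_pmf.emeasure_le_1 order_trans by blast
  next
    case False
    have "emeasure (measure_pmf (path_pmf K (Suc n) u)) {xs. set xs \<inter> S \<noteq> {}} =
      (\<integral>\<^sup>+v. emeasure (measure_pmf (path_pmf K n v)) {xs. set xs \<inter> S \<noteq> {}} \<partial>measure_pmf (K u))"
      using False by (simp add: emeasure_bind_pmf emeasure_map_pmf vimage_def)
    also have "\<dots> \<le> (\<integral>\<^sup>+v. g v \<partial>measure_pmf (K u))"
      using assms(2) Suc False by (intro nn_integral_mono_AE) (auto simp: AE_measure_pmf_iff)
    also have "\<dots> \<le> g u" using assms(3) Suc.prems False by blast
    finally show ?thesis .
  qed
qed

section \<open>The law of the walk through its finite paths\<close>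

lemma measurable_biased_walk_component [measurable]:
  "(\<lambda>X. X k) \<in> measurable (biased_walk lam T x) (count_space UNIV)"
  by (subst measurable_cong_sets[OF sets_biased_walk refl]) simp

lemma space_biased_walk [simp]: "space (biased_walk lam T x) = UNIV"
  using sets_eq_imp_space_eq[OF sets_biased_walk[of lam T x]] by (simp add: space_PiM)

lemma measurable_map_biased_walk [measurable]:
  "(\<lambda>X. map X ks) \<in> measurable (biased_walk lam T x) (count_space UNIV)"
proof (induction ks)
  case (Cons k ks)
  note [measurable] = Cons
  have "(\<lambda>X. (\<lambda>v X. v # map X ks) (X k) X) \<in> measurable (biased_walk lam T x) (count_space UNIV)"
    by (rule measurable_compose_countable) (auto intro: measurable_compose[OF Cons])
  then show ?case by simp
qed simp

text \<open>Both sides give a single path the product of its transition probabilities, and there are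
  only countably many paths. This trades the Ionescu-Tulcea measure for discrete path laws.\<close>

lemma distr_biased_walk:
  "distr (biased_walk lam T x) (count_space UNIV) (\<lambda>X. map X [0..<Suc n]) =
    measure_pmf (path_pmf (biased_step lam T) n x)"
proof (rule measure_eqI_countable[where A=UNIV])
  fix xs :: "vertex list"
  have "emeasure (distr (biased_walk lam T x) (count_space UNIV) (\<lambda>X. map X [0..<Suc n])) {xs} =
    emeasure (biased_walk lam T x) {X. map X [0..<Suc n] = xs}"
    by (subst emeasure_distr) (auto simp del: upt_Suc simp: vimage_def)
  also have "\<dots> = ennreal (pmf (path_pmf (biased_step lam T) n x) xs)"
  proof (cases "length xs = Suc n")
    case True
    then have "{X. map X [0..<Suc n] = xs} = {X. \<forall>i\<le>n. X i = xs ! i}"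
      by (auto simp: list_eq_iff_nth_eq less_Suc_eq_le simp del: upt_Suc)
    then show ?thesis using True
      by (simp add: emeasure_biased_walk_cylinder pmf_path_pmf prod_ennreal del: upt_Suc)
  next
    case False
    then have "{X. map X [0..<Suc n] = xs} = {}" by auto
    moreover have "pmf (path_pmf (biased_step lam T) n x) xs = 0"
      using False length_path_pmf by (metis set_pmf_iff)
    ultimately show ?thesis by simp
  qed
  finally show "emeasure (distr (biased_walk lam T x) (count_space UNIV) (\<lambda>X. map X [0..<Suc n])) {xs} =
      emeasure (measure_pmf (path_pmf (biased_step lam T) n x)) {xs}"
    by (simp add: emeasure_pmf_single)
qed auto

lemma emeasure_biased_walk_hit_le:
  fixes g :: "vertex \<Rightarrow> ennreal"
  assumes "\<And>u. u \<in> S \<Longrightarrow> 1 \<le> g u"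
    and "\<And>u. u \<in> V - S \<Longrightarrow> set_pmf (biased_step lam T u) \<subseteq> V"
    and "\<And>u. u \<in> V - S \<Longrightarrow> (\<integral>\<^sup>+v. g v \<partial>measure_pmf (biased_step lam T u)) \<le> g u"
    and "x \<in> V"
  shows "emeasure (biased_walk lam T x) {X. \<exists>k. X k \<in> S} \<le> g x"
proof -
  define B where "B n = {X :: nat \<Rightarrow> vertex. \<exists>k\<le>n. X k \<in> S}" for n :: nat
  have B_eq: "B n = {X. set (map X [0..<Suc n]) \<inter> S \<noteq> {}}" for n
    unfolding B_def by (auto simp: less_Suc_eq_le disjoint_iff simp del: upt_Suc)
  have B: "B n \<in> sets (biased_walk lam T x)" for n
  proof -
    have "(\<lambda>X. map X [0..<Suc n]) -` {xs. set xs \<inter> S \<noteq> {}} \<inter> space (biased_walk lam T x) \<in> sets (biased_walk lam T x)"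
      by (rule measurable_sets[OF measurable_map_biased_walk]) simp
    then show ?thesis by (simp add: B_eq vimage_def del: upt_Suc)
  qed
  have "emeasure (biased_walk lam T x) (B n) =
      emeasure (distr (biased_walk lam T x) (count_space UNIV) (\<lambda>X. map X [0..<Suc n])) {xs. set xs \<inter> S \<noteq> {}}" for n
    by (subst emeasure_distr) (auto simp: B_eq vimage_def simp del: upt_Suc)
  then have le: "emeasure (biased_walk lam T x) (B n) \<le> g x" for n
    unfolding distr_biased_walk using emeasure_path_pmf_hit_le[of S g V, OF assms] by simp
  have "{X. \<exists>k. X k \<in> S} = (\<Union>n. B n)"
    by (auto simp: B_def)
  moreover have "(SUP n. emeasure (biased_walk lam T x) (B n)) = emeasure (biased_walk lam T x) (\<Union>n. B n)"
    using B by (intro SUP_emeasure_incseq) (auto simp: B_def incseq_def intro: order_trans)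
  ultimately show ?thesis using le by (metis SUP_least)
qed

section \<open>Rays, limit rays and the harmonic measure\<close>

lemma rays_length: "\<omega> \<in> rays T \<Longrightarrow> length (\<omega> n) = n"
  by (induction n) (auto simp: rays_def children_def, metis length_append_singleton)

lemma rays_take: "\<omega> \<in> rays T \<Longrightarrow> k \<le> n \<Longrightarrow> take k (\<omega> n) = \<omega> k"
proof (induction n)
  case (Suc n)
  then obtain i where i: "\<omega> (Suc n) = \<omega> n @ [i]" by (auto simp: rays_def children_def)
  show ?case
    using Suc i rays_length[OF Suc.prems(1)] by (cases "k = Suc n") auto
qed (simp add: rays_def)

lemma rays_mem: "\<omega> \<in> rays T \<Longrightarrow> \<omega> (Suc n) \<in> T"
  by (auto simp: rays_def children_def)

lemma rays_through_iff: "\<omega> \<in> rays_through T x \<longleftrightarrow> \<omega> \<in> rays T \<and> \<omega> (length x) = x"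
  by (auto simp: rays_through_def rays_length intro: rev_image_eqI[of "length x"])

text \<open>
  On a trajectory without limit ray the description in \<open>limit_ray\<close> is empty at all large levels, so
  that \<open>limit_ray\<close> takes one and the same junk value there and is not a ray.
\<close>

lemma limit_ray_eventually:
  assumes "limit_ray X \<in> rays T"
  shows "\<forall>\<^sub>F k in sequentially. take n (X k) = limit_ray X n"
proof -
  define P where "P n v \<longleftrightarrow> length v = n \<and> (\<forall>\<^sub>F k in sequentially. take n (X k) = v)" for n v
  have lr: "limit_ray X n = (THE v. P n v)" for n by (simp add: limit_ray_def P_def)
  have uniq: "v = w" if "P n v" "P n w" for n v w
    using that eventually_conj[of "\<lambda>k. take n (X k) = v" sequentially "\<lambda>k. take n (X k) = w"]
    by (auto simp: P_def dest!: eventually_happens)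
  have ex: "\<exists>v. P n v"
  proof (rule ccontr)
    assume none: "\<nexists>v. P n v"
    \<comment> \<open>Failure passes upwards: a stable ancestor at level \<open>n'\<close> would
      yield one at level \<open>n\<close> by truncation. Hence levels \<open>n\<close> and
      \<open>Suc n\<close> share the same junk value, although a ray has vertices of different
      lengths there.\<close>
    have "\<not> P n' v" if "n \<le> n'" for n' v
    proof
      assume P: "P n' v"
      have "take n (X k) = take n v" if "take n' (X k) = v" for k
        using that \<open>n \<le> n'\<close> by (auto simp: min_absorb1)
      then have "P n (take n v)"
        using P that by (auto simp: P_def elim!: eventually_mono)
      then show False using none by blast
    qed
    then have "limit_ray X n' = (THE v. False)" if "n \<le> n'" for n' using that by (simp add: lr)
    from this[of n] this[of "Suc n"] rays_length[OF assms] show False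
      by (metis le_refl le_SucI n_not_Suc_n)
  qed
  then have "P n (limit_ray X n)" unfolding lr using uniq by (metis theI)
  then show ?thesis by (simp add: P_def)
qed

text \<open>A limit ray through \<open>x\<close> forces the walk to be eventually at or below
  \<open>x\<close>, hence to visit that set.\<close>

lemma emeasure_HARM_le:
  "emeasure (HARM lam T) (rays_through T x) \<le>
    emeasure (biased_walk lam T []) {X. \<exists>k. take (length x) (X k) = x}"
proof (cases "rays_through T x \<in> sets (HARM lam T)")
  case True
  have "{X. \<exists>k. take (length x) (X k) = x} = (\<Union>k. {X \<in> space (biased_walk lam T []). X k \<in> {u. take (length x) u = x}})"
    by auto
  also have "\<dots> \<in> sets (biased_walk lam T [])" by measurable
  finally have meas: "{X. \<exists>k. take (length x) (X k) = x} \<in> sets (biased_walk lam T [])" .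
  have "emeasure (HARM lam T) (rays_through T x) = emeasure (biased_walk lam T []) (limit_ray -` rays_through T x)"
    using True unfolding HARM_def by (subst emeasure_distr[OF measurable_limit_ray]) auto
  also have "\<dots> \<le> emeasure (biased_walk lam T []) {X. \<exists>k. take (length x) (X k) = x}"
  proof (rule emeasure_mono[OF subsetI meas])
    fix X assume "X \<in> limit_ray -` rays_through T x"
    then show "X \<in> {X. \<exists>k. take (length x) (X k) = x}"
      using limit_ray_eventually[of X T "length x"]
      by (auto simp: rays_through_iff dest!: eventually_happens)
  qed
  finally show ?thesis .
qed (simp add: emeasure_notin_sets)

lemma sets_rays_through: "rays_through T x \<in> sets (HARM lam T)"
proof -
  let ?M = "\<Pi>\<^sub>M n\<in>(UNIV :: nat set). count_space (UNIV :: vertex set)"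
  have [measurable]: "(\<lambda>\<omega>. \<omega> n) \<in> measurable ?M (count_space UNIV)" for n
    by (rule measurable_component_singleton) simp
  have [measurable]: "Measurable.pred ?M (\<lambda>\<omega>. \<omega> (Suc n) \<in> children T (\<omega> n))" for n
  proof -
    have "Measurable.pred ?M (\<lambda>\<omega>. (\<lambda>v \<omega>. \<omega> (Suc n) \<in> children T v) (\<omega> n) \<omega>)"
      by (rule measurable_compose_countable) measurable
    then show ?thesis by simp
  qed
  have "{\<omega> \<in> space ?M. \<omega> 0 = [] \<and> (\<forall>n. \<omega> (Suc n) \<in> children T (\<omega> n)) \<and> \<omega> (length x) = x} \<in> sets ?M"
    by measurable
  moreover have "{\<omega> \<in> space ?M. \<omega> 0 = [] \<and> (\<forall>n. \<omega> (Suc n) \<in> children T (\<omega> n)) \<and> \<omega> (length x) = x} = rays_through T x"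
    by (auto simp: rays_through_iff rays_def space_PiM)
  ultimately show ?thesis by (simp add: HARM_def)
qed

lemma AE_HARM_rays:
  assumes "measure_hausdorff_dim (rays T) d (HARM lam T) \<noteq> \<infinity>"
  shows "AE \<omega> in HARM lam T. \<omega> \<in> rays T"
proof -
  let ?A = "{E \<in> sets (HARM lam T). E \<subseteq> rays T \<and> space (HARM lam T) - E \<in> null_sets (HARM lam T)}"
  have "?A \<noteq> {}"
  proof
    assume "?A = {}"
    then show False using assms unfolding measure_hausdorff_dim_def by (simp only: image_empty Inf_empty top_ereal_def)
  qed
  then obtain E where E: "E \<subseteq> rays T" "space (HARM lam T) - E \<in> null_sets (HARM lam T)" by blast
  from AE_not_in[OF E(2)] AE_space show ?thesis
    by eventually_elim (use E(1) in blast)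
qed

text \<open>The vertices of zero harmonic measure are countably many, so the rays through any of
  them form a null set. Positivity makes the logarithms in the decay rate meaningful.\<close>

lemma AE_HARM_positive:
  assumes "AE \<omega> in HARM lam T. \<omega> \<in> rays T"
  shows "AE \<omega> in HARM lam T. \<forall>n. 0 < measure (HARM lam T) (rays_through T (\<omega> n))"
proof -
  interpret prob_space "HARM lam T" by (rule prob_space_HARM)
  have "AE \<omega> in HARM lam T. \<forall>x. \<omega> \<in> rays_through T x \<longrightarrow> 0 < prob (rays_through T x)"
    unfolding AE_all_countable
  proof
    fix x
    show "AE \<omega> in HARM lam T. \<omega> \<in> rays_through T x \<longrightarrow> 0 < prob (rays_through T x)"
    proof (cases "prob (rays_through T x) = 0")
      case True
      then have "AE \<omega> in HARM lam T. \<omega> \<notin> rays_through T x"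
        by (intro AE_not_in) (auto simp: null_sets_def sets_rays_through emeasure_eq_measure)
      then show ?thesis by eventually_elim simp
    qed (auto simp: order_less_le)
  qed
  with assms show ?thesis
    by eventually_elim (auto simp: rays_through_iff rays_length)
qed

subsection \<open>Upper bounds on harmonic measure\<close>

lemma Nil_in_gw_tree [simp]: "[] \<in> gw_tree \<nu>"
  by (simp add: gw_tree_def)

lemma snoc_in_gw_tree: "u @ [i] \<in> gw_tree \<nu> \<longleftrightarrow> u \<in> gw_tree \<nu> \<and> i < \<nu> u"
  by (auto simp: gw_tree_def nth_append less_Suc_eq)

lemma Cons_in_gw_tree: "i # u \<in> gw_tree \<nu> \<longleftrightarrow> i < \<nu> [] \<and> u \<in> gw_tree (shift [i] \<nu>)"
  by (auto simp: gw_tree_def shift_def All_less_Suc2)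

lemma butlast_in_gw_tree: "u \<in> gw_tree \<nu> \<Longrightarrow> butlast u \<in> gw_tree \<nu>"
  by (cases u rule: rev_cases) (auto simp: snoc_in_gw_tree)

lemma children_gw_tree:
  assumes "u \<in> gw_tree \<nu>"
  shows "children (gw_tree \<nu>) u = (\<lambda>i. u @ [i]) ` {..<\<nu> u}"
  using assms by (auto simp: children_def snoc_in_gw_tree)

lemma nn_integral_biased_step:
  fixes g :: "vertex \<Rightarrow> real"
  assumes "0 < lam" "u \<in> gw_tree \<nu>" "0 < \<nu> u" and g: "\<And>v. 0 \<le> g v"
  shows "(\<integral>\<^sup>+v. ennreal (g v) \<partial>measure_pmf (biased_step lam (gw_tree \<nu>) u)) =
    ennreal (if u = [] then (\<Sum>i<\<nu> u. g (u @ [i])) / \<nu> u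
      else (lam * g (butlast u) + (\<Sum>i<\<nu> u. g (u @ [i]))) / (lam + \<nu> u))"
proof -
  let ?C = "children (gw_tree \<nu>) u"
  have inj: "inj_on (\<lambda>i. u @ [i]) {..<\<nu> u}" by (auto simp: inj_on_def)
  have C: "?C = (\<lambda>i. u @ [i]) ` {..<\<nu> u}" by (rule children_gw_tree[OF assms(2)])
  have fin: "finite ?C" and ne: "?C \<noteq> {}" and card: "card ?C = \<nu> u"
    using assms(3) by (auto simp: C card_image[OF inj])
  have sum: "sum g ?C = (\<Sum>i<\<nu> u. g (u @ [i]))" by (simp add: C sum.reindex[OF inj])
  have unif: "(\<integral>\<^sup>+v. ennreal (g v) \<partial>measure_pmf (pmf_of_set ?C)) = ennreal (sum g ?C / \<nu> u)"
    using g fin ne by (simp add: nn_integral_pmf_of_set card sum_ennreal divide_ennreal sum_nonneg assms(3) ennreal_of_nat_eq_real_of_nat)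
  show ?thesis
  proof (cases "u = []")
    case True
    then show ?thesis using unif sum by (simp add: biased_step_def)
  next
    case False
    define q where "q = lam / (lam + \<nu> u)"
    have q: "0 \<le> q" "q \<le> 1" using assms by (auto simp: q_def field_simps)
    have "(\<integral>\<^sup>+v. ennreal (g v) \<partial>measure_pmf (biased_step lam (gw_tree \<nu>) u)) =
        (\<integral>\<^sup>+b. (if b then ennreal (g (butlast u)) else ennreal (sum g ?C / \<nu> u)) \<partial>measure_pmf (bernoulli_pmf q))"
      using False unfolding biased_step_def card q_def[symmetric]
      by (simp add: nn_integral_bind_pmf, intro nn_integral_cong, simp add: unif)
    also have "\<dots> = ennreal (g (butlast u)) * ennreal q + ennreal (sum g ?C / \<nu> u) * ennreal (1 - q)"
      using q by (subst nn_integral_bernoulli_pmf) auto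
    also have "\<dots> = ennreal (g (butlast u) * q + sum g ?C / \<nu> u * (1 - q))"
      using q g by (simp add: ennreal_mult'[symmetric] ennreal_plus[symmetric] sum_nonneg del: ennreal_plus)
    also have "g (butlast u) * q + sum g ?C / \<nu> u * (1 - q) = (lam * g (butlast u) + sum g ?C) / (lam + \<nu> u)"
    proof -
      have "1 - q = \<nu> u / (lam + \<nu> u)" using assms by (simp add: q_def field_simps)
      then show ?thesis using assms(3) by (simp add: q_def add_divide_distrib mult.commute)
    qed
    finally show ?thesis using False sum by simp
  qed
qed

lemma set_biased_step_subset:
  assumes "0 < lam" "u \<in> gw_tree \<nu>" "0 < \<nu> u"
  shows "set_pmf (biased_step lam (gw_tree \<nu>) u) \<subseteq> gw_tree \<nu>"
proof -
  have C: "children (gw_tree \<nu>) u = (\<lambda>i. u @ [i]) ` {..<\<nu> u}" by (rule children_gw_tree[OF assms(2)])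
  then have pos: "set_pmf (pmf_of_set (children (gw_tree \<nu>) u)) = children (gw_tree \<nu>) u"
    using assms(3) by (intro set_pmf_of_set) auto
  have "set_pmf (biased_step lam (gw_tree \<nu>) u) \<subseteq> insert (butlast u) (children (gw_tree \<nu>) u)"
  proof (cases "u = []")
    case True
    then show ?thesis using pos by (simp add: biased_step_def) blast
  next
    case False
    then show ?thesis unfolding biased_step_def if_not_P[OF False] set_bind_pmf
      by (intro UN_least) (simp add: pos subset_insertI)
  qed
  also have "\<dots> \<subseteq> gw_tree \<nu>"
    using butlast_in_gw_tree[OF assms(2)] by (auto simp: children_def)
  finally show ?thesis .
qed

text \<open>
  \<open>hit_prob lam R k\<close> bounds the probability that the walk started at the \<open>k\<close>-th vertex of a path
  ever reaches the next one, if \<open>R k\<close> is the total conductance to infinity of the other subtrees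
  attached to the \<open>k\<close>-th vertex.
\<close>

primrec hit_prob :: "real \<Rightarrow> (nat \<Rightarrow> real) \<Rightarrow> nat \<Rightarrow> real" where
  "hit_prob lam R 0 = 1 / (1 + R 0)"
| "hit_prob lam R (Suc k) = 1 / (1 + lam * (1 - hit_prob lam R k) + R (Suc k))"

lemma hit_prob_bounds:
  assumes "0 < lam" "\<And>k. 0 \<le> R k"
  shows "0 < hit_prob lam R k" "hit_prob lam R k \<le> 1" "hit_prob lam R k \<le> 1 / (1 + R k)"
proof -
  have "0 < hit_prob lam R k \<and> hit_prob lam R k \<le> 1 / (1 + R k)"
  proof (induction k)
    case (Suc k)
    have "1 / (1 + R k) \<le> 1" using assms(2)[of k] by (simp add: field_simps)
    then have "0 \<le> lam * (1 - hit_prob lam R k)" using Suc assms(1) by (intro mult_nonneg_nonneg) auto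
    then show ?case using assms(2)[of "Suc k"] by (auto intro!: divide_left_mono divide_pos_pos mult_pos_pos add_pos_nonneg)
  qed (use assms(2)[of 0] in auto)
  moreover have "1 / (1 + R k) \<le> 1" using assms(2)[of k] by (simp add: field_simps)
  ultimately show "0 < hit_prob lam R k" "hit_prob lam R k \<le> 1 / (1 + R k)" "hit_prob lam R k \<le> 1"
    by auto
qed

lemma prod_hit_prob_le1:
  assumes "0 < lam" "\<And>k. 0 \<le> R k"
  shows "(\<Prod>k<n. hit_prob lam R k) \<le> (\<Prod>k<n. 1 / (1 + R k))"
  using hit_prob_bounds[OF assms] by (intro prod_mono) (auto simp: less_imp_le)

text \<open>The induction carries the stronger bound with the extra factor \<open>1 - ?a n\<close>,
  which is dropped at the end. At \<open>n = 0\<close> it is the equality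
  \<open>R 0 * ?a 0 = 1 - ?a 0\<close>; the inductive step exchanges
  \<open>lam * ?a (Suc n) * (1 - ?a n)\<close> for a new factor of the product times
  \<open>1 - ?a (Suc n)\<close>.\<close>

lemma prod_hit_prob_le2:
  assumes "0 < lam" "\<And>k. 0 \<le> R k"
  shows "R 0 * (\<Prod>k<Suc n. hit_prob lam R k) * lam ^ n \<le> (\<Prod>k<n. lam / (lam + R (Suc k)))"
proof -
  let ?a = "hit_prob lam R"
  have a: "0 < ?a k" "?a k \<le> 1" for k by (rule hit_prob_bounds[OF assms])+
  have "R 0 * (\<Prod>k<Suc n. ?a k) * lam ^ n \<le> (\<Prod>k<n. lam / (lam + R (Suc k))) * (1 - ?a n)"
  proof (induction n)
    case 0
    show ?case using assms(2)[of 0] by (simp add: field_simps)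
  next
    case (Suc n)
    let ?d = "1 - ?a n" and ?r = "R (Suc n)"
    have r: "0 \<le> ?r" and d: "0 \<le> ?d" "?d \<le> 1" using assms(2) a[of n] by auto
    have step: "lam * ?a (Suc n) * ?d \<le> lam / (lam + ?r) * (1 - ?a (Suc n))"
    proof -
      have D: "0 < 1 + lam * ?d + ?r" using r d assms(1) by (intro add_pos_nonneg) auto
      have "lam * ?d \<le> lam / (lam + ?r) * (lam * ?d + ?r)"
      proof -
        have "(lam + ?r) * ?d \<le> lam * ?d + ?r" using mult_left_le[OF d(2) r] by (simp add: algebra_simps)
        then have "lam * ((lam + ?r) * ?d) \<le> lam * (lam * ?d + ?r)" using assms(1) by (intro mult_left_mono) auto
        then show ?thesis using assms(1) r by (simp add: field_simps)
      qed
      then have "lam * ?d * ?a (Suc n) \<le> lam / (lam + ?r) * (lam * ?d + ?r) * ?a (Suc n)"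
        using a(1)[of "Suc n"] by (intro mult_right_mono) auto
      also have "\<dots> = lam / (lam + ?r) * ((lam * ?d + ?r) * ?a (Suc n))"
        by (simp only: mult.assoc)
      \<comment> \<open>This is the recursion for \<open>hit_prob\<close> with its denominator
        cleared.\<close>
      also have "(lam * ?d + ?r) * ?a (Suc n) = 1 - ?a (Suc n)"
        using D by (simp add: field_simps)
      finally show ?thesis by (simp only: ac_simps)
    qed
    have "R 0 * (\<Prod>k<Suc (Suc n). ?a k) * lam ^ Suc n =
        (R 0 * (\<Prod>k<Suc n. ?a k) * lam ^ n) * (lam * ?a (Suc n))"
      by (simp add: ac_simps del: hit_prob.simps)
    also have "\<dots> \<le> ((\<Prod>k<n. lam / (lam + R (Suc k))) * ?d) * (lam * ?a (Suc n))"
      using Suc a(1)[of "Suc n"] assms(1) by (intro mult_right_mono) auto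
    also have "\<dots> = (\<Prod>k<n. lam / (lam + R (Suc k))) * (lam * ?a (Suc n) * ?d)"
      by (simp only: ac_simps)
    also have "\<dots> \<le> (\<Prod>k<n. lam / (lam + R (Suc k))) * (lam / (lam + ?r) * (1 - ?a (Suc n)))"
      using assms by (intro mult_left_mono step prod_nonneg) (auto intro: add_nonneg_nonneg less_imp_le)
    finally show ?case by (simp add: ac_simps del: hit_prob.simps)
  qed
  also have "\<dots> \<le> (\<Prod>k<n. lam / (lam + R (Suc k)))"
    using a[of n] assms by (intro mult_left_le prod_nonneg) (auto intro: add_nonneg_nonneg less_imp_le)
  finally show ?thesis .
qed

definition siblings_sum :: "(vertex \<Rightarrow> nat) \<Rightarrow> (vertex \<Rightarrow> real) \<Rightarrow> vertex \<Rightarrow> nat \<Rightarrow> real" where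
  "siblings_sum \<nu> b x k = (\<Sum>i\<in>{..<\<nu> (take k x)} - {x ! k}. b (take k x @ [i]))"

text \<open>The maximum principle is applied to an explicit function \<open>g\<close> that is
  \<open>1\<close> at and below \<open>x\<close>, superharmonic elsewhere on the tree, and equal to
  the product of the \<open>hit_prob\<close> values at the root. The hypothesis relating
  \<open>b\<close> to its values at the children is what superharmonicity amounts to off the
  path.\<close>

lemma emeasure_HARM_rays_through_le:
  fixes b :: "vertex \<Rightarrow> real"
  assumes lam: "0 < lam" and pos: "\<And>u. 0 < \<nu> u" and b0: "\<And>u. 0 \<le> b u" and b1: "\<And>u. b u < 1"
    and sub: "\<And>u. lam \<le> (1 - b u) * (lam + (\<Sum>i<\<nu> u. b (u @ [i])))"
    and x: "x \<in> gw_tree \<nu>"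
  shows "emeasure (HARM lam (gw_tree \<nu>)) (rays_through (gw_tree \<nu>) x) \<le>
    ennreal (\<Prod>k<length x. hit_prob lam (siblings_sum \<nu> b x) k)"
proof -
  define n where "n = length x"
  define R where "R = siblings_sum \<nu> b x"
  define a where "a = hit_prob lam R"
  have R0: "0 \<le> R k" for k unfolding R_def siblings_sum_def by (intro sum_nonneg b0)
  have a: "0 < a k" for k unfolding a_def by (rule hit_prob_bounds[OF lam R0])
  define S where "S = {u. take n u = x}"
  \<comment> \<open>An edge is named by its lower endpoint \<open>v\<close>, so on the path it
    starts at the vertex with index \<open>length v - 1\<close>.\<close>
  define c where "c v = (if take (length v) x = v then 1 / a (length v - 1) else 1 - b v)" for v
  \<comment> \<open>\<open>h u\<close> stands for the probability of reaching \<open>x\<close> from \<open>u\<close>: a step along the path gains a factor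
    \<open>1 / a k\<close>, and a step to a child \<open>v\<close> off the path costs \<open>1 - b v\<close>, the probability of coming back.\<close>
  define h where "h u = (\<Prod>k<n. a k) * (\<Prod>i<length u. c (take (Suc i) u))" for u
  define g where "g u = (if u \<in> S then 1 else h u)" for u
  have c0: "0 \<le> c v" for v using a[of "length v - 1"] b1[of v] by (auto simp: c_def less_imp_le)
  have h0: "0 \<le> h u" for u
    unfolding h_def using a c0 by (intro mult_nonneg_nonneg prod_nonneg) (auto simp: less_imp_le)
  have g0: "0 \<le> g u" for u using h0 by (simp add: g_def)
  have h_snoc: "h (u @ [i]) = h u * c (u @ [i])" for u i
    by (simp add: h_def mult.assoc)
  have hx: "h x = 1"
  proof -
    have "(\<Prod>i<n. c (take (Suc i) x)) = (\<Prod>i<n. 1 / a i)"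
      by (intro prod.cong refl) (simp add: c_def n_def min_absorb2 Suc_le_eq)
    then show ?thesis
      using a by (simp add: h_def n_def[symmetric] prod.distrib[symmetric] less_imp_neq[symmetric])
  qed
  \<comment> \<open>The only way to enter \<open>S\<close> from outside by a downward step is to
    step onto \<open>x\<close>, where \<open>h\<close> is \<open>1\<close> as well.\<close>
  have g_child: "g (u @ [i]) = h u * c (u @ [i])" if "u \<notin> S" for u i
  proof (cases "u @ [i] \<in> S")
    case True
    have "\<not> n \<le> length u" using True that by (auto simp: S_def)
    then have "u @ [i] = x" using True by (simp add: S_def)
    then show ?thesis using True hx h_snoc[of u i] by (simp add: g_def)
  qed (simp add: g_def h_snoc)
  have g_parent: "g (butlast u) = h (butlast u)" if "u \<notin> S" for u
  proof -
    have "butlast u \<notin> S" using that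
      by (cases u rule: rev_cases) (auto simp: S_def n_def)
    then show ?thesis by (simp add: g_def)
  qed
  have superharmonic: "(\<integral>\<^sup>+v. ennreal (g v) \<partial>measure_pmf (biased_step lam (gw_tree \<nu>) u)) \<le> ennreal (g u)"
    if u: "u \<in> gw_tree \<nu> - S" for u
  proof -
    define N where "N = real (\<nu> u)"
    have N: "0 < N" using pos[of u] by (simp add: N_def)
    have gu: "g u = h u" using u by (simp add: g_def)
    define C where "C = (\<Sum>i<\<nu> u. c (u @ [i]))"
    have sumC: "(\<Sum>i<\<nu> u. g (u @ [i])) = h u * C"
      using u by (simp add: g_child C_def sum_distrib_left)
    have off: "C = N - (\<Sum>i<\<nu> u. b (u @ [i]))" if "take (length u) x \<noteq> u"
    proof -
      have "take (Suc (length u)) x \<noteq> u @ [i]" for i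
      proof
        assume "take (Suc (length u)) x = u @ [i]"
        then have "take (length u) (take (Suc (length u)) x) = u" by simp
        then show False using that by (simp add: min_absorb1)
      qed
      then have "c (u @ [i]) = 1 - b (u @ [i])" for i by (simp add: c_def)
      then show ?thesis by (simp add: C_def N_def sum_subtractf)
    qed
    \<comment> \<open>On the path exactly one child continues it. Since \<open>x\<close> itself
      belongs to \<open>S\<close>, such a \<open>u\<close> is a proper ancestor of
      \<open>x\<close>.\<close>
    have on: "C = N - 1 - R (length u) + 1 / a (length u)" and xu: "x ! length u < \<nu> u"
      if tk: "take (length u) x = u"
    proof -
      have lu: "length u < n"
      proof (rule ccontr)
        assume "\<not> length u < n"
        then have "take (length u) x = x" by (simp add: n_def)
        then show False using u tk by (auto simp: S_def n_def)
      qed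
      have tS: "take (Suc (length u)) x = u @ [x ! length u]"
        using lu tk by (simp add: take_Suc_conv_app_nth n_def)
      then have "u @ [x ! length u] \<in> gw_tree \<nu>"
        using x lu by (auto simp: gw_tree_def n_def simp flip: tS)
      then show xu: "x ! length u < \<nu> u" by (simp add: snoc_in_gw_tree)
      have "C = c (u @ [x ! length u]) + (\<Sum>i\<in>{..<\<nu> u} - {x ! length u}. c (u @ [i]))"
        unfolding C_def using xu by (intro sum.remove) auto
      also have "c (u @ [x ! length u]) = 1 / a (length u)" using tS by (simp add: c_def)
      also have "(\<Sum>i\<in>{..<\<nu> u} - {x ! length u}. c (u @ [i])) = (\<Sum>i\<in>{..<\<nu> u} - {x ! length u}. 1 - b (u @ [i]))"
        using tS by (intro sum.cong refl) (auto simp: c_def)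
      also have "\<dots> = N - 1 - R (length u)"
        using xu by (simp add: sum_subtractf R_def siblings_sum_def tk N_def of_nat_diff card_Diff_singleton)
      finally show "C = N - 1 - R (length u) + 1 / a (length u)" by simp
    qed
    show ?thesis
    proof (cases "u = []")
      case True
      have "1 / a 0 = 1 + R 0" using R0[of 0] by (simp add: a_def)
      then have "C = N" using on True by simp
      then have "(\<Sum>i<\<nu> u. g (u @ [i])) / \<nu> u = g u" using N by (simp add: sumC gu N_def)
      then show ?thesis using nn_integral_biased_step[OF lam _ pos g0, of u] u True by simp
    next
      case False
      then obtain w j where w: "u = w @ [j]" by (cases u rule: rev_cases) auto
      then have bw: "butlast u = w" by simp
      \<comment> \<open>On the path the recursion for \<open>hit_prob\<close> makes this an
        equality; off the path it is the hypothesis \<open>sub\<close> times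
        \<open>h w\<close>.\<close>
      have "lam * h w + h u * C \<le> h u * (lam + N)"
      proof (cases "take (length u) x = u")
        case True
        have hw: "h w = h u * a (length w)"
          using True a[of "length w"] by (simp add: w h_snoc c_def)
        have "1 / a (length u) = 1 + lam * (1 - a (length w)) + R (length u)"
          using a[of "length u"] by (simp add: w a_def)
        then have "C = N + lam * (1 - a (length w))" using on[OF True] by simp
        then have "lam * h w + h u * C = h u * (lam + N)" unfolding hw by algebra
        then show ?thesis by simp
      next
        case False
        have hu: "h u = h w * (1 - b u)" using False by (simp add: w h_snoc c_def)
        have "h w * lam \<le> h w * ((1 - b u) * (lam + (\<Sum>i<\<nu> u. b (u @ [i]))))"
          by (intro mult_left_mono sub h0)
        then show ?thesis unfolding off[OF False] hu by (simp add: algebra_simps)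
      qed
      then have "(lam * g (butlast u) + (\<Sum>i<\<nu> u. g (u @ [i]))) / (lam + \<nu> u) \<le> g u"
        using lam N u bw g_parent[of u] by (simp add: divide_le_eq sumC gu N_def)
      then show ?thesis
        using nn_integral_biased_step[OF lam _ pos g0, of u] u False by (simp add: ennreal_leI)
    qed
  qed
  have "emeasure (HARM lam (gw_tree \<nu>)) (rays_through (gw_tree \<nu>) x) \<le>
      emeasure (biased_walk lam (gw_tree \<nu>) []) {X. \<exists>k. X k \<in> S}"
    using emeasure_HARM_le[of lam "gw_tree \<nu>" x] by (simp add: S_def n_def)
  also have "\<dots> \<le> ennreal (g [])"
    using superharmonic set_biased_step_subset[OF lam _ pos]
    by (intro emeasure_biased_walk_hit_le[where V="gw_tree \<nu>"]) (auto simp: g_def)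
  \<comment> \<open>For \<open>n = 0\<close> the root lies in \<open>S\<close>, and its value
    \<open>1\<close> is the empty product.\<close>
  also have "g [] = (\<Prod>k<n. a k)"
    by (auto simp: g_def S_def n_def h_def)
  finally show ?thesis by (simp add: n_def a_def R_def)
qed

subsection \<open>Branchings along all rays\<close>

text \<open>
  The weight of a path is \<open>\<theta>\<close> raised to the number of its vertices at which some other child has
  percolation survival probability larger than \<open>\<epsilon>\<close>.
\<close>

definition step_weight :: "real \<Rightarrow> real \<Rightarrow> real \<Rightarrow> (vertex \<Rightarrow> nat) \<Rightarrow> nat \<Rightarrow> real" where
  "step_weight L \<epsilon> \<theta> \<nu> i =
    (if \<exists>j<\<nu> []. j \<noteq> i \<and> \<epsilon> < perc_surv L (shift [j] \<nu>) then \<theta> else 1)"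

text \<open>The sum of the path weights over the vertices of generation \<open>n\<close>, decomposed
  at the root.\<close>

primrec total_weight :: "real \<Rightarrow> real \<Rightarrow> real \<Rightarrow> nat \<Rightarrow> (vertex \<Rightarrow> nat) \<Rightarrow> real" where
  "total_weight L \<epsilon> \<theta> 0 \<nu> = 1"
| "total_weight L \<epsilon> \<theta> (Suc n) \<nu> =
    (\<Sum>i<\<nu> []. step_weight L \<epsilon> \<theta> \<nu> i * total_weight L \<epsilon> \<theta> n (shift [i] \<nu>))"

lemma step_weight_nonneg: "0 \<le> \<theta> \<Longrightarrow> 0 \<le> step_weight L \<epsilon> \<theta> \<nu> i"
  by (simp add: step_weight_def)

lemma total_weight_nonneg: "0 \<le> \<theta> \<Longrightarrow> 0 \<le> total_weight L \<epsilon> \<theta> n \<nu>"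
  by (induction n arbitrary: \<nu>) (auto intro!: sum_nonneg mult_nonneg_nonneg step_weight_nonneg)

lemma path_weight_le_total_weight:
  assumes "0 \<le> \<theta>" "x \<in> gw_tree \<nu>"
  shows "(\<Prod>k<length x. step_weight L \<epsilon> \<theta> (shift (take k x) \<nu>) (x ! k)) \<le> total_weight L \<epsilon> \<theta> (length x) \<nu>"
  using assms(2)
proof (induction x arbitrary: \<nu>)
  case (Cons i x)
  then have i: "i < \<nu> []" "x \<in> gw_tree (shift [i] \<nu>)" by (auto simp: Cons_in_gw_tree)
  have "(\<Prod>k<length (i # x). step_weight L \<epsilon> \<theta> (shift (take k (i # x)) \<nu>) ((i # x) ! k)) =
      step_weight L \<epsilon> \<theta> \<nu> i * (\<Prod>k<length x. step_weight L \<epsilon> \<theta> (shift (take k x) (shift [i] \<nu>)) (x ! k))"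
    unfolding length_Cons prod.lessThan_Suc_shift by simp
  also have "\<dots> \<le> step_weight L \<epsilon> \<theta> \<nu> i * total_weight L \<epsilon> \<theta> (length x) (shift [i] \<nu>)"
    by (intro mult_left_mono Cons.IH i step_weight_nonneg assms)
  also have "\<dots> \<le> total_weight L \<epsilon> \<theta> (length (i # x)) \<nu>"
    unfolding length_Cons total_weight.simps using i assms
    by (intro member_le_sum) (auto intro!: mult_nonneg_nonneg step_weight_nonneg total_weight_nonneg)
  finally show ?case .
qed simp

lemma measurable_total_weight [measurable]:
  "total_weight L \<epsilon> \<theta> n \<in> borel_measurable (gw_offspring p)"
proof (induction n)
  case (Suc n)
  note [measurable] = measurable_compose[OF measurable_shift Suc]
    measurable_compose[OF measurable_shift measurable_perc_surv]
  have [measurable]: "(\<lambda>\<nu>. step_weight L \<epsilon> \<theta> \<nu> i) \<in> borel_measurable (gw_offspring p)" for i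
  proof -
    have "(\<lambda>\<nu>. (\<lambda>k \<nu>. if \<exists>j<k. j \<noteq> i \<and> \<epsilon> < perc_surv L (shift [j] \<nu>) then \<theta> else 1) (\<nu> []) \<nu>)
        \<in> borel_measurable (gw_offspring p)"
      by (rule measurable_compose_countable) measurable
    then show ?thesis by (simp add: step_weight_def)
  qed
  have "(\<lambda>\<nu>. (\<lambda>k \<nu>. \<Sum>i<k. step_weight L \<epsilon> \<theta> \<nu> i * total_weight L \<epsilon> \<theta> n (shift [i] \<nu>)) (\<nu> []) \<nu>)
      \<in> borel_measurable (gw_offspring p)"
    by (rule measurable_compose_countable) measurable
  then show ?case by simp
qed simp

text \<open>A first moment recursion with a marked child: either some sibling conducts well and the
  step costs \<open>\<theta>\<close>, or all \<open>k - 1\<close> siblings conduct badly, which has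
  probability \<open>q ^ (k - 1)\<close>. Averaging over \<open>k\<close> gives at most the factor
  \<open>\<rho>\<close> per generation.\<close>

lemma nn_integral_total_weight_le:
  assumes \<theta>: "0 \<le> \<theta>" and int: "integrable (measure_pmf p) real"
    and q: "q = measure (gw_offspring p) {\<nu>. perc_surv L \<nu> \<le> \<epsilon>}"
  defines "\<rho> \<equiv> pmf p 1 + (\<theta> + q) * measure_pmf.expectation p real"
  shows "(\<integral>\<^sup>+\<nu>. ennreal (total_weight L \<epsilon> \<theta> n \<nu>) \<partial>gw_offspring p) \<le> ennreal (\<rho> ^ n)"
proof (induction n)
  case 0
  interpret prob_space "gw_offspring p" by (rule prob_space_gw_offspring)
  show ?case by (simp add: emeasure_space_1[simplified])
next
  case (Suc n)
  interpret prob_space "gw_offspring p" by (rule prob_space_gw_offspring)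
  let ?G = "gw_offspring p"
  define Q where "Q = {\<nu>. perc_surv L \<nu> \<le> \<epsilon>}"
  have Q [measurable]: "Q \<in> sets ?G"
  proof -
    have "{\<nu> \<in> space ?G. perc_surv L \<nu> \<le> \<epsilon>} \<in> sets ?G" by measurable
    then show ?thesis by (simp add: Q_def)
  qed
  have q01: "0 \<le> q" "q \<le> 1" by (auto simp: q)
  have m: "0 \<le> measure_pmf.expectation p real" by (intro Bochner_Integration.integral_nonneg) simp
  have \<rho>: "0 \<le> \<rho>" using \<theta> q01 m by (simp add: \<rho>_def)
  define Z where "Z \<nu> = ennreal (total_weight L \<epsilon> \<theta> n \<nu>)" for \<nu>
  have Z [measurable]: "Z \<in> borel_measurable ?G" unfolding Z_def[abs_def] by measurable
  \<comment> \<open>With \<open>b\<close> true, the marked child \<open>a\<close> pays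
    \<open>\<theta>\<close> and its siblings are free; with \<open>b\<close> false, it pays nothing
    but every sibling must lie in \<open>Q\<close>. The sum of the two cases dominates the true
    weight.\<close>
  define f where "f b a i = (if i = a then (\<lambda>\<nu>. ennreal (if b then \<theta> else 1) * Z \<nu>) else if b then (\<lambda>_. 1) else indicator Q)"
    for b and a i :: nat
  have f [measurable]: "f b a i \<in> borel_measurable ?G" for b a i by (simp add: f_def)
  have intf: "(\<Prod>i<k. \<integral>\<^sup>+\<nu>. f b a i \<nu> \<partial>?G) = ennreal (if b then \<theta> else q ^ (k - 1)) * (\<integral>\<^sup>+\<nu>. Z \<nu> \<partial>?G)"
    if "a < k" for b a k
  proof -
    have "(\<Prod>i<k. \<integral>\<^sup>+\<nu>. f b a i \<nu> \<partial>?G) =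
        (\<integral>\<^sup>+\<nu>. f b a a \<nu> \<partial>?G) * (\<Prod>i\<in>{..<k} - {a}. \<integral>\<^sup>+\<nu>. f b a i \<nu> \<partial>?G)"
      using that by (intro prod.remove) auto
    also have "(\<Prod>i\<in>{..<k} - {a}. \<integral>\<^sup>+\<nu>. f b a i \<nu> \<partial>?G) = (\<Prod>i\<in>{..<k} - {a}. ennreal (if b then 1 else q))"
      by (intro prod.cong refl)
        (auto simp: f_def prob_space[simplified] q Q_def[symmetric] emeasure_eq_measure)
    also have "\<dots> = ennreal (if b then 1 else q ^ (k - 1))"
      using that q01 by (auto simp: ennreal_power card_Diff_singleton)
    finally show ?thesis using \<theta> q01 by (simp add: f_def nn_integral_cmult mult.commute)
  qed
  have pw: "ennreal (step_weight L \<epsilon> \<theta> \<nu> a * total_weight L \<epsilon> \<theta> n (shift [a] \<nu>)) \<le>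
      (\<Prod>i<\<nu> []. f True a i (shift [i] \<nu>)) + (\<Prod>i<\<nu> []. f False a i (shift [i] \<nu>))"
    if "a < \<nu> []" for \<nu> a
  proof -
    have P: "(\<Prod>i<\<nu> []. f b a i (shift [i] \<nu>)) =
        f b a a (shift [a] \<nu>) * (\<Prod>i\<in>{..<\<nu> []} - {a}. f b a i (shift [i] \<nu>))" for b
      using that by (intro prod.remove) auto
    show ?thesis
    proof (cases "\<exists>j<\<nu> []. j \<noteq> a \<and> \<epsilon> < perc_surv L (shift [j] \<nu>)")
      case True
      have "(\<Prod>i<\<nu> []. f True a i (shift [i] \<nu>)) = ennreal \<theta> * Z (shift [a] \<nu>)"
        unfolding P by (simp add: f_def)
      then show ?thesis using True \<theta> by (simp add: step_weight_def Z_def ennreal_mult')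
    next
      case False
      then have "shift [i] \<nu> \<in> Q" if "i < \<nu> []" "i \<noteq> a" for i
        using that unfolding Q_def mem_Collect_eq by (meson not_le)
      then have "(\<Prod>i\<in>{..<\<nu> []} - {a}. f False a i (shift [i] \<nu>)) = 1"
        by (intro prod.neutral) (simp add: f_def)
      then have "(\<Prod>i<\<nu> []. f False a i (shift [i] \<nu>)) = Z (shift [a] \<nu>)"
        unfolding P by (simp add: f_def)
      then show ?thesis unfolding step_weight_def if_not_P[OF False] by (simp add: Z_def)
    qed
  qed
  have [measurable]: "(\<lambda>\<nu>. \<Sum>a<\<nu> []. \<Prod>i<\<nu> []. f b a i (shift [i] \<nu>)) \<in> borel_measurable ?G" for b
  proof -
    note [measurable] = measurable_compose[OF measurable_shift f]
    have "(\<lambda>\<nu>. (\<lambda>k \<nu>. \<Sum>a<k. \<Prod>i<k. f b a i (shift [i] \<nu>)) (\<nu> []) \<nu>) \<in> borel_measurable ?G"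
      by (rule measurable_compose_countable) measurable
    then show ?thesis by simp
  qed
  \<comment> \<open>An only child has no siblings to bring a gain, whence the term that becomes
    \<open>pmf p 1\<close>; for \<open>k \<ge> 2\<close> at least one factor \<open>q\<close> is
    available.\<close>
  have bound: "real k * (\<theta> + q ^ (k - 1)) \<le> indicator {1::nat} k + (\<theta> + q) * real k" for k
  proof -
    have "k * q ^ (k - 1) \<le> indicator {1::nat} k + q * k"
    proof (cases "k \<le> 1")
      case True
      then have "k = 0 \<or> k = 1" by auto
      then show ?thesis using q01 by auto
    next
      case False
      then have "q ^ (k - 1) \<le> q ^ 1" using q01 by (intro power_decreasing) auto
      then show ?thesis using False by (simp add: mult.commute mult_right_mono)
    qed
    then show ?thesis by (simp add: algebra_simps)
  qed
  have br: "(\<integral>\<^sup>+\<nu>. (\<Sum>a<\<nu> []. \<Prod>i<\<nu> []. f b a i (shift [i] \<nu>)) \<partial>?G) =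
      (\<integral>\<^sup>+k. (\<Sum>a<k. \<Prod>i<k. \<integral>\<^sup>+\<nu>. f b a i \<nu> \<partial>?G) \<partial>measure_pmf p)" for b
    by (rule nn_integral_branching) (rule f)
  have "(\<integral>\<^sup>+\<nu>. ennreal (total_weight L \<epsilon> \<theta> (Suc n) \<nu>) \<partial>?G) =
      (\<integral>\<^sup>+\<nu>. (\<Sum>a<\<nu> []. ennreal (step_weight L \<epsilon> \<theta> \<nu> a * total_weight L \<epsilon> \<theta> n (shift [a] \<nu>))) \<partial>?G)"
    using \<theta> by (intro nn_integral_cong) (simp add: sum_ennreal step_weight_nonneg total_weight_nonneg)
  also have "\<dots> \<le> (\<integral>\<^sup>+\<nu>. (\<Sum>a<\<nu> []. \<Prod>i<\<nu> []. f True a i (shift [i] \<nu>)) +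
      (\<Sum>a<\<nu> []. \<Prod>i<\<nu> []. f False a i (shift [i] \<nu>)) \<partial>?G)"
    unfolding sum.distrib[symmetric] by (intro nn_integral_mono sum_mono pw) simp
  also have "\<dots> = (\<integral>\<^sup>+k. (\<Sum>a<k. \<Prod>i<k. \<integral>\<^sup>+\<nu>. f True a i \<nu> \<partial>?G) \<partial>measure_pmf p) +
      (\<integral>\<^sup>+k. (\<Sum>a<k. \<Prod>i<k. \<integral>\<^sup>+\<nu>. f False a i \<nu> \<partial>?G) \<partial>measure_pmf p)"
    by (simp add: nn_integral_add br)
  also have "\<dots> = (\<integral>\<^sup>+k. (\<Sum>a<k. \<Prod>i<k. \<integral>\<^sup>+\<nu>. f True a i \<nu> \<partial>?G) + (\<Sum>a<k. \<Prod>i<k. \<integral>\<^sup>+\<nu>. f False a i \<nu> \<partial>?G) \<partial>measure_pmf p)"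
    by (simp add: nn_integral_add)
  also have "\<dots> = (\<integral>\<^sup>+k. ennreal (k * (\<theta> + q ^ (k - 1))) * (\<integral>\<^sup>+\<nu>. Z \<nu> \<partial>?G) \<partial>measure_pmf p)"
    using \<theta> q01 by (intro nn_integral_cong)
      (simp add: intf ennreal_mult ennreal_plus ennreal_of_nat_eq_real_of_nat algebra_simps)
  also have "\<dots> \<le> (\<integral>\<^sup>+k. ennreal (indicator {1::nat} k + (\<theta> + q) * k) * (\<integral>\<^sup>+\<nu>. Z \<nu> \<partial>?G) \<partial>measure_pmf p)"
    by (intro nn_integral_mono mult_right_mono ennreal_leI bound) simp
  also have "\<dots> = (\<integral>\<^sup>+k. ennreal (indicator {1::nat} k + (\<theta> + q) * k) \<partial>measure_pmf p) * (\<integral>\<^sup>+\<nu>. Z \<nu> \<partial>?G)"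
    by (simp add: nn_integral_multc)
  also have "(\<integral>\<^sup>+k. ennreal (indicator {1::nat} k + (\<theta> + q) * k) \<partial>measure_pmf p) = ennreal \<rho>"
  proof -
    have int1: "integrable (measure_pmf p) (\<lambda>k. indicator {1::nat} k :: real)"
      by (intro integrable_real_indicator) (simp_all add: less_top[symmetric])
    have int2: "integrable (measure_pmf p) (\<lambda>k. (\<theta> + q) * real k)" using int by simp
    have "(\<integral>\<^sup>+k. ennreal (indicator {1::nat} k + (\<theta> + q) * k) \<partial>measure_pmf p) =
        ennreal (measure_pmf.expectation p (\<lambda>k. indicator {1::nat} k + (\<theta> + q) * real k))"
      using \<theta> q01 int1 int2 by (intro nn_integral_eq_integral Bochner_Integration.integrable_add) auto
    also have "measure_pmf.expectation p (\<lambda>k. indicator {1::nat} k + (\<theta> + q) * real k) = \<rho>"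
      using int1 int2 by (subst Bochner_Integration.integral_add) (simp_all add: \<rho>_def measure_pmf_single)
    finally show ?thesis .
  qed
  also have "ennreal \<rho> * (\<integral>\<^sup>+\<nu>. Z \<nu> \<partial>?G) \<le> ennreal \<rho> * ennreal (\<rho> ^ n)"
    using Suc by (intro mult_left_mono) (auto simp: Z_def)
  also have "\<dots> = ennreal (\<rho> ^ Suc n)" using \<rho> by (simp add: ennreal_mult')
  finally show ?case .
qed

text \<open>The weights divided by \<open>r ^ n\<close> have expectations bounded by a geometric
  series of ratio \<open>\<rho> / r < 1\<close>, so almost surely they are summable and tend to
  \<open>0\<close>.\<close>

lemma AE_total_weight_eventually_le:
  assumes \<theta>: "0 \<le> \<theta>" and \<rho>: "0 \<le> \<rho>" "\<rho> < r"
    and le: "\<And>n. (\<integral>\<^sup>+\<nu>. ennreal (total_weight L \<epsilon> \<theta> n \<nu>) \<partial>gw_offspring p) \<le> ennreal (\<rho> ^ n)"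
  shows "AE \<nu> in gw_offspring p. \<forall>\<^sub>F n in sequentially. total_weight L \<epsilon> \<theta> n \<nu> \<le> r ^ n"
proof -
  let ?G = "gw_offspring p"
  let ?Z = "total_weight L \<epsilon> \<theta>"
  have r: "0 < r" using \<rho> by simp
  have "(\<integral>\<^sup>+\<nu>. (\<Sum>n. ennreal (?Z n \<nu> / r ^ n)) \<partial>?G) = (\<Sum>n. \<integral>\<^sup>+\<nu>. ennreal (?Z n \<nu> / r ^ n) \<partial>?G)"
    by (intro nn_integral_suminf) measurable
  also have "\<dots> \<le> (\<Sum>n. ennreal ((\<rho> / r) ^ n))"
  proof (intro suminf_le summableI)
    fix n
    have "(\<integral>\<^sup>+\<nu>. ennreal (?Z n \<nu> / r ^ n) \<partial>?G) = (\<integral>\<^sup>+\<nu>. ennreal (1 / r ^ n) * ennreal (?Z n \<nu>) \<partial>?G)"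
      using r \<theta> by (intro nn_integral_cong) (simp add: ennreal_mult'[symmetric])
    also have "\<dots> = ennreal (1 / r ^ n) * (\<integral>\<^sup>+\<nu>. ennreal (?Z n \<nu>) \<partial>?G)"
      by (intro nn_integral_cmult) measurable
    also have "\<dots> \<le> ennreal (1 / r ^ n) * ennreal (\<rho> ^ n)" by (intro mult_left_mono le) simp
    also have "\<dots> = ennreal ((\<rho> / r) ^ n)" using r by (simp add: ennreal_mult'[symmetric] power_divide)
    finally show "(\<integral>\<^sup>+\<nu>. ennreal (?Z n \<nu> / r ^ n) \<partial>?G) \<le> ennreal ((\<rho> / r) ^ n)" .
  qed
  also have "\<dots> < \<infinity>"
    using \<rho> r by (subst suminf_ennreal2) (auto intro!: summable_geometric)
  finally have "AE \<nu> in ?G. (\<Sum>n. ennreal (?Z n \<nu> / r ^ n)) \<noteq> \<infinity>"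
    by (intro nn_integral_PInf_AE) auto
  then show ?thesis
  proof eventually_elim
    case (elim \<nu>)
    then have "summable (\<lambda>n. ?Z n \<nu> / r ^ n)"
      using \<theta> r by (intro summable_suminf_not_top) (auto simp: total_weight_nonneg)
    then have "(\<lambda>n. ?Z n \<nu> / r ^ n) \<longlonglongrightarrow> 0" by (rule summable_LIMSEQ_zero)
    then have "\<forall>\<^sub>F n in sequentially. ?Z n \<nu> / r ^ n < 1" by (rule order_tendstoD) simp
    then show ?case by eventually_elim (use r in \<open>simp add: field_simps\<close>)
  qed
qed

text \<open>Continuity from above along the thresholds \<open>inverse (Suc n)\<close>, whose events
  decrease to a null event.\<close>

lemma exists_small_surv_prob:
  assumes "AE \<nu> in gw_offspring p. 0 < perc_surv L \<nu>" "0 < \<delta>"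
  shows "\<exists>\<epsilon>>0. measure (gw_offspring p) {\<nu>. perc_surv L \<nu> \<le> \<epsilon>} < \<delta>"
proof -
  interpret prob_space "gw_offspring p" by (rule prob_space_gw_offspring)
  let ?G = "gw_offspring p"
  define A where "A n = {\<nu>. perc_surv L \<nu> \<le> inverse (real (Suc n))}" for n
  have A: "A n \<in> sets ?G" for n
  proof -
    have "{\<nu> \<in> space ?G. perc_surv L \<nu> \<le> inverse (real (Suc n))} \<in> sets ?G" by measurable
    then show ?thesis by (simp add: A_def)
  qed
  have "(\<lambda>n. prob (A n)) \<longlonglongrightarrow> prob (\<Inter>n. A n)"
  proof (intro finite_Lim_measure_decseq)
    show "decseq A"
      unfolding decseq_def A_def
      by (auto elim!: order_trans simp: le_imp_inverse_le)
  qed (use A in auto)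
  moreover have "prob (\<Inter>n. A n) = 0"
  proof -
    have "AE \<nu> in ?G. \<nu> \<notin> (\<Inter>n. A n)"
      using assms(1)
    proof eventually_elim
      case (elim \<nu>)
      then obtain n where "inverse (real (Suc n)) < perc_surv L \<nu>" using reals_Archimedean by blast
      then show ?case by (auto simp: A_def not_le)
    qed
    then have "(\<Inter>n. A n) \<in> null_sets ?G" using A by (subst AE_iff_null_sets) auto
    then show ?thesis by (simp add: measure_eq_0_null_sets)
  qed
  ultimately have "\<forall>\<^sub>F n in sequentially. prob (A n) < \<delta>" using assms(2) by (intro order_tendstoD(2)) auto
  then obtain n where "prob (A n) < \<delta>" by (auto simp: eventually_sequentially)
  then show ?thesis unfolding A_def by (intro exI[of _ "inverse (real (Suc n))"]) auto
qed

subsection \<open>The decay rate\<close>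

lemma hit_prob_cong: "(\<And>j. j \<le> k \<Longrightarrow> R j = R' j) \<Longrightarrow> hit_prob lam R k = hit_prob lam R' k"
  by (induction k) auto

lemma exponential_rate_ge:
  fixes H :: "nat \<Rightarrow> real"
  assumes lim: "(\<lambda>n. - (1 / real n) * ln (H n)) \<longlonglongrightarrow> \<beta>"
    and H: "\<And>n. 0 < H n" and C: "0 < C" and s: "0 < s"
    and le: "\<forall>\<^sub>F n in sequentially. H n \<le> C * s ^ n"
  shows "- ln s \<le> \<beta>"
proof (rule tendsto_le[OF _ lim])
  have "(\<lambda>n. - (1 / real n) * ln C - ln s) \<longlonglongrightarrow> - 0 * ln C - ln s"
    by (intro tendsto_intros lim_1_over_n)
  then show "(\<lambda>n. - (1 / real n) * ln C - ln s) \<longlonglongrightarrow> - ln s" by simp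
  show "\<forall>\<^sub>F n in sequentially. - (1 / real n) * ln C - ln s \<le> - (1 / real n) * ln (H n)"
    using le eventually_gt_at_top[of 0]
  proof eventually_elim
    case (elim n)
    have "ln (H n) \<le> ln (C * s ^ n)" using elim H[of n] by (intro ln_mono) auto
    also have "\<dots> = ln C + n * ln s" using C s by (simp add: ln_mult ln_realpow)
    finally have "ln (H n) / n \<le> (ln C + n * ln s) / n" by (intro divide_right_mono) auto
    then show ?case using elim by (simp add: add_divide_distrib)
  qed
qed simp

text \<open>The exponent \<open>ln \<kappa> / ln \<theta>\<close> turns \<open>\<theta>\<close> into
  \<open>\<kappa>\<close>, so each \<open>\<phi> k\<close> is at most that power of
  \<open>w k\<close>, and exponential decay passes from the weights to the factors.\<close>

lemma prod_le_powr_of_weights: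
  fixes \<phi> w :: "nat \<Rightarrow> real"
  assumes \<theta>: "0 < \<theta>" "\<theta> < 1" and \<kappa>: "0 < \<kappa>" "\<kappa> < 1" and r: "0 < r"
    and \<phi>: "\<And>k. 0 \<le> \<phi> k" "\<And>k. \<phi> k \<le> 1"
    and w: "\<And>k. w k = 1 \<or> w k = \<theta> \<and> \<phi> k \<le> \<kappa>"
    and le: "(\<Prod>k<n. w k) \<le> r ^ n"
  shows "(\<Prod>k<n. \<phi> k) \<le> (r powr (ln \<kappa> / ln \<theta>)) ^ n"
proof -
  let ?a = "ln \<kappa> / ln \<theta>"
  have a: "0 < ?a" using \<theta> \<kappa> by (simp add: divide_neg_neg)
  have "\<theta> powr ?a = \<kappa>" using \<theta> \<kappa> by (simp add: powr_def)
  then have "\<phi> k \<le> w k powr ?a" for k using w[of k] \<phi>(2)[of k] by auto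
  moreover have w0: "0 \<le> w k" for k using w[of k] \<theta> by auto
  ultimately have "(\<Prod>k<n. \<phi> k) \<le> (\<Prod>k<n. w k powr ?a)" by (intro prod_mono) (simp add: \<phi>)
  also have "\<dots> = (\<Prod>k<n. w k) powr ?a" using w0 by (simp add: prod_powr_distrib)
  also have "\<dots> \<le> (r ^ n) powr ?a" using le w0 a by (intro powr_mono2 prod_nonneg) auto
  also have "\<dots> = (r powr ?a) ^ n" using r by (simp add: powr_realpow[symmetric] powr_powr mult.commute)
  finally show ?thesis .
qed

text \<open>The deterministic part of the argument, for one tree and one ray with the properties
  that hold almost surely.\<close>

lemma ray_rate_bounds:
  fixes \<nu> :: "vertex \<Rightarrow> nat"
  assumes lam: "0 < lam" "lam < L" "1 \<le> L" and \<epsilon>: "0 < \<epsilon>" and \<theta>: "0 < \<theta>" "\<theta> < 1" and r: "0 < r" "r < 1"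
    and pos: "\<And>u. 0 < \<nu> u" and root: "\<nu> [] \<noteq> 1" and surv: "\<And>u. 0 < perc_surv L (shift u \<nu>)"
    and Z: "\<forall>\<^sub>F n in sequentially. total_weight L \<epsilon> \<theta> n \<nu> \<le> r ^ n"
    and \<omega>: "\<omega> \<in> rays (gw_tree \<nu>)"
    and H: "\<And>n. 0 < measure (HARM lam (gw_tree \<nu>)) (rays_through (gw_tree \<nu>) (\<omega> n))"
    and lim: "(\<lambda>n. - (1 / real n) * ln (measure (HARM lam (gw_tree \<nu>)) (rays_through (gw_tree \<nu>) (\<omega> n))))
             \<longlonglongrightarrow> \<beta>"
  shows "max 0 (ln lam) < \<beta>"
proof -
  define c where "c = 1 - lam / L"
  have c: "0 < c" "c < 1" using lam by (auto simp: c_def)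
  define b where "b u = c * perc_surv L (shift u \<nu>)" for u
  have b0: "0 < b u" for u using surv c by (simp add: b_def)
  have b1: "b u < 1" for u
    using mult_left_mono[OF perc_surv_bounds(2)[OF lam(3), of "shift u \<nu>"] less_imp_le[OF c(1)]] c(2)
    unfolding b_def by linarith
  have sub: "lam \<le> (1 - b u) * (lam + (\<Sum>i<\<nu> u. b (u @ [i])))" for u
    using perc_surv_subsolution[OF lam(3) lam(1,2), of "shift u \<nu>"] by (simp add: b_def c_def)
  \<comment> \<open>The siblings along the ray at level \<open>k\<close> are determined by
    \<open>\<omega> (Suc k)\<close>, so one sequence \<open>R\<close> serves the paths to all later
    \<open>\<omega> n\<close>.\<close>
  define R where "R k = siblings_sum \<nu> b (\<omega> (Suc k)) k" for k
  have take_\<omega>: "take k (\<omega> n) = \<omega> k" if "k \<le> n" for k n by (rule rays_take[OF \<omega> that])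
  have len: "length (\<omega> n) = n" for n by (rule rays_length[OF \<omega>])
  have nth_\<omega>: "\<omega> n ! k = \<omega> (Suc k) ! k" if "k < n" for k n
    using take_\<omega>[of "Suc k" n] that by (metis Suc_leI lessI nth_take)
  have R_eq: "siblings_sum \<nu> b (\<omega> n) k = R k" if "k < n" for k n
    using that by (simp add: R_def siblings_sum_def take_\<omega> nth_\<omega>[OF that])
  have R0: "0 \<le> R k" for k
    unfolding R_def siblings_sum_def using b0 by (intro sum_nonneg) (simp add: less_imp_le)
  have R_ge: "b (\<omega> k @ [j]) \<le> R k" if "j < \<nu> (\<omega> k)" "j \<noteq> \<omega> (Suc k) ! k" for j k
  proof -
    have "R k = (\<Sum>i\<in>{..<\<nu> (\<omega> k)} - {\<omega> (Suc k) ! k}. b (\<omega> k @ [i]))"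
      by (simp add: R_def siblings_sum_def take_\<omega>)
    then show ?thesis
      using member_le_sum[of j "{..<\<nu> (\<omega> k)} - {\<omega> (Suc k) ! k}" "\<lambda>i. b (\<omega> k @ [i])"] that b0
      by (simp add: less_imp_le)
  qed
  define A where "A n = (\<Prod>k<n. hit_prob lam R k)" for n
  define h where "h n = measure (HARM lam (gw_tree \<nu>)) (rays_through (gw_tree \<nu>) (\<omega> n))" for n
  have \<omega>_mem: "\<omega> n \<in> gw_tree \<nu>" for n
    using rays_mem[OF \<omega>] \<omega> by (cases n) (auto simp: rays_def)
  have hA: "h n \<le> A n" for n
  proof -
    interpret prob_space "HARM lam (gw_tree \<nu>)" by (rule prob_space_HARM)
    have A0: "0 \<le> A n" unfolding A_def using hit_prob_bounds(1)[OF lam(1) R0] by (intro prod_nonneg) (simp add: less_imp_le)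
    have "(\<Prod>k<length (\<omega> n). hit_prob lam (siblings_sum \<nu> b (\<omega> n)) k) = A n"
      unfolding A_def len by (intro prod.cong refl hit_prob_cong R_eq) auto
    then have "ennreal (h n) \<le> ennreal (A n)"
      using emeasure_HARM_rays_through_le[where x="\<omega> n" and b=b, OF lam(1) pos _ b1 sub \<omega>_mem] b0
      by (simp add: h_def emeasure_eq_measure less_imp_le)
    then show ?thesis using A0 by simp
  qed
  define w where "w k = step_weight L \<epsilon> \<theta> (shift (\<omega> k) \<nu>) (\<omega> (Suc k) ! k)" for k
  have "(\<Prod>k<n. w k) \<le> total_weight L \<epsilon> \<theta> n \<nu>" for n
  proof -
    have "(\<Prod>k<length (\<omega> n). step_weight L \<epsilon> \<theta> (shift (take k (\<omega> n)) \<nu>) (\<omega> n ! k)) \<le> total_weight L \<epsilon> \<theta> (length (\<omega> n)) \<nu>"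
      using \<theta> by (intro path_weight_le_total_weight \<omega>_mem) simp
    moreover have "(\<Prod>k<n. step_weight L \<epsilon> \<theta> (shift (take k (\<omega> n)) \<nu>) (\<omega> n ! k)) = (\<Prod>k<n. w k)"
    proof (intro prod.cong refl)
      fix k assume "k \<in> {..<n}"
      then have "take k (\<omega> n) = \<omega> k" "\<omega> n ! k = \<omega> (Suc k) ! k" using take_\<omega>[of k n] nth_\<omega>[of k n] by auto
      then show "step_weight L \<epsilon> \<theta> (shift (take k (\<omega> n)) \<nu>) (\<omega> n ! k) = w k" by (simp only: w_def)
    qed
    ultimately show ?thesis by (simp add: len)
  qed
  then have Zw: "\<forall>\<^sub>F n in sequentially. (\<Prod>k<n. w k) \<le> r ^ n"
    using Z by (auto elim!: eventually_mono intro: order_trans)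
  define \<eta> where "\<eta> = c * \<epsilon>"
  have \<eta>: "0 < \<eta>" using c \<epsilon> by (simp add: \<eta>_def)
  have w: "w k = 1 \<or> w k = \<theta> \<and> \<eta> \<le> R k" for k
  proof (cases "\<exists>j<\<nu> (\<omega> k). j \<noteq> \<omega> (Suc k) ! k \<and> \<epsilon> < perc_surv L (shift (\<omega> k @ [j]) \<nu>)")
    case True
    then obtain j where j: "j < \<nu> (\<omega> k)" "j \<noteq> \<omega> (Suc k) ! k" "\<epsilon> < perc_surv L (shift (\<omega> k @ [j]) \<nu>)" by blast
    have "\<eta> \<le> b (\<omega> k @ [j])" using j c by (simp add: \<eta>_def b_def)
    also have "\<dots> \<le> R k" using R_ge j by blast
    finally show ?thesis by (simp add: w_def step_weight_def)
  qed (auto simp: w_def step_weight_def)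
  \<comment> \<open>Common form of the two estimates, used with \<open>d = 1\<close> and
    \<open>d = lam\<close>. Strictness comes from the extra decay of the product: the exponent of
    \<open>r\<close> is positive and \<open>ln r < 0\<close>.\<close>
  have rate: "ln d < \<beta>"
    if \<kappa>: "0 < \<kappa>" "\<kappa> < 1" and d: "0 < d" and C: "0 < C"
      and \<phi>: "\<And>k. 0 \<le> \<phi> k" "\<And>k. \<phi> k \<le> 1" "\<And>k. \<eta> \<le> R k \<Longrightarrow> \<phi> k \<le> \<kappa>"
      and AC: "\<And>n. 0 < n \<Longrightarrow> A n \<le> C * (1 / d) ^ n * (\<Prod>k<n. \<phi> k)"
    for \<kappa> d C :: real and \<phi> :: "nat \<Rightarrow> real"
  proof -
    let ?s = "1 / d * r powr (ln \<kappa> / ln \<theta>)"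
    have "- ln ?s \<le> \<beta>"
    proof (rule exponential_rate_ge[OF lim[folded h_def] _ C])
      show "0 < h n" for n using H by (simp add: h_def)
      show "0 < ?s" using d r by simp
      show "\<forall>\<^sub>F n in sequentially. h n \<le> C * ?s ^ n"
        using Zw eventually_gt_at_top[of 0]
      proof eventually_elim
        case (elim n)
        have "(\<Prod>k<n. \<phi> k) \<le> (r powr (ln \<kappa> / ln \<theta>)) ^ n"
        proof (rule prod_le_powr_of_weights[OF \<theta> \<kappa> r(1) \<phi>(1,2) _ elim(1)])
          show "w k = 1 \<or> w k = \<theta> \<and> \<phi> k \<le> \<kappa>" for k using w[of k] \<phi>(3) by blast
        qed
        then have "C * (1 / d) ^ n * (\<Prod>k<n. \<phi> k) \<le> C * (1 / d) ^ n * (r powr (ln \<kappa> / ln \<theta>)) ^ n"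
          using C d by (intro mult_left_mono) auto
        then have "h n \<le> C * (1 / d) ^ n * (r powr (ln \<kappa> / ln \<theta>)) ^ n"
          using hA[of n] AC[OF elim(2)] by linarith
        then show ?case by (simp only: power_mult_distrib mult.assoc)
      qed
    qed
    moreover have "- ln ?s = ln d - ln \<kappa> / ln \<theta> * ln r"
      using d r by (simp add: ln_mult ln_div ln_powr)
    moreover have "0 < ln \<kappa> / ln \<theta>" using \<theta> \<kappa> by (simp add: divide_neg_neg)
    then have "ln \<kappa> / ln \<theta> * ln r < 0" using r by (intro mult_pos_neg) simp_all
    ultimately show ?thesis by linarith
  qed
  have "0 < \<beta>"
  proof -
    have "A n \<le> 1 * (1 / 1) ^ n * (\<Prod>k<n. 1 / (1 + R k))" for n
      using prod_hit_prob_le1[where R=R and n=n, OF lam(1) R0] by (simp add: A_def)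
    then have "ln 1 < \<beta>"
      using \<eta> R0
      by (intro rate[of "1 / (1 + \<eta>)" 1 1 "\<lambda>k. 1 / (1 + R k)"])
        (auto intro!: divide_left_mono mult_pos_pos add_pos_nonneg simp: divide_le_eq add_pos_nonneg)
    then show ?thesis by simp
  qed
  moreover have "ln lam < \<beta>"
  proof -
    \<comment> \<open>The root has a second child, so something branches off there; otherwise the
      bound carrying the factor \<open>R 0\<close> would be void.\<close>
    have "R 0 > 0"
    proof -
      obtain j where j: "j < \<nu> []" "j \<noteq> \<omega> (Suc 0) ! 0"
        using root pos[of "[]"] by (metis One_nat_def less_one linorder_neqE_nat not_less_eq zero_neq_one)
      then have "b [j] \<le> R 0" using R_ge[of j 0] len[of 0] by simp
      then show ?thesis using b0[of "[j]"] by linarith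
    qed
    \<comment> \<open>The second product estimate starts at level \<open>1\<close>. Inserting the
      missing factor \<open>lam / (lam + R 0)\<close> and dividing by \<open>R 0\<close> leaves this
      constant.\<close>
    define C where "C = (lam + R 0) / R 0"
    have C: "0 < C" using \<open>R 0 > 0\<close> lam by (simp add: C_def)
    have "A n \<le> C * (1 / lam) ^ n * (\<Prod>k<n. lam / (lam + R k))" if "0 < n" for n
    proof -
      obtain N where N: "n = Suc N" using \<open>0 < n\<close> gr0_implies_Suc by blast
      have "(\<Prod>k<n. lam / (lam + R k)) = lam / (lam + R 0) * (\<Prod>k<N. lam / (lam + R (Suc k)))"
        unfolding N prod.lessThan_Suc_shift by simp
      then have eq: "(\<Prod>k<N. lam / (lam + R (Suc k))) = (lam + R 0) / lam * (\<Prod>k<n. lam / (lam + R k))"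
        using lam \<open>R 0 > 0\<close> by simp
      have "R 0 * A n * lam ^ N \<le> (lam + R 0) / lam * (\<Prod>k<n. lam / (lam + R k))"
        using prod_hit_prob_le2[where R=R and n=N, OF lam(1) R0] unfolding eq A_def N .
      then have "R 0 * A n * lam ^ N * lam \<le> (lam + R 0) / lam * (\<Prod>k<n. lam / (lam + R k)) * lam"
        using lam by (intro mult_right_mono) auto
      then have "A n * (R 0 * lam ^ n) \<le> (lam + R 0) * (\<Prod>k<n. lam / (lam + R k))"
        using lam by (simp add: N ac_simps)
      then show ?thesis using lam \<open>R 0 > 0\<close>
        by (simp add: C_def power_divide pos_le_divide_eq[symmetric] ac_simps)
    qed
    moreover have "0 < lam + R k" for k using R0[of k] lam(1) by simp
    ultimately show ?thesis
      using \<eta> R0 lam(1) C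
      by (intro rate[of "lam / (lam + \<eta>)" lam C "\<lambda>k. lam / (lam + R k)"])
        (auto intro!: divide_left_mono mult_pos_pos)
  qed
  ultimately show ?thesis by simp
qed

text \<open>As \<open>\<beta>\<close> is deterministic, one tree and one ray with all the required
  properties suffice. The tree is chosen with a branching root, an event of positive
  probability.\<close>

theorem corollary3p7:
  fixes p :: "nat pmf" and lam \<beta> :: real
  assumes "pmf p 0 = 0"
    and "pmf p 1 \<noteq> 1"
    and "integrable (measure_pmf p) real"
    and "1 < measure_pmf.expectation p real"
    and "0 < lam"
    and "lam < measure_pmf.expectation p real"
    and "AE \<nu> in gw_offspring p.
           measure_hausdorff_dim (rays (gw_tree \<nu>)) ray_dist (HARM lam (gw_tree \<nu>)) = ereal \<beta>"
    and "AE \<nu> in gw_offspring p. AE \<omega> in HARM lam (gw_tree \<nu>).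
           (\<lambda>n. - (1 / real n) * ln (measure (HARM lam (gw_tree \<nu>)) (rays_through (gw_tree \<nu>) (\<omega> n))))
             \<longlonglongrightarrow> \<beta>"
  shows "\<beta> > max 0 (ln lam)"
proof -
  define m where "m = measure_pmf.expectation p real"
  define L where "L = (max 1 lam + m) / 2"
  have L: "1 \<le> L" "lam < L" "L < m" using assms(4,6) by (auto simp: L_def m_def max_def)
  have m: "1 < m" using assms(4) by (simp add: m_def)
  have surv: "AE \<nu> in gw_offspring p. 0 < perc_surv L \<nu>"
    using assms L by (intro AE_perc_surv_pos) (auto simp: m_def)
  have p1: "0 \<le> pmf p 1" "pmf p 1 < 1" using assms(2) pmf_le_1[of p 1] by (auto simp: order_less_le)
  \<comment> \<open>Chosen so that \<open>\<theta> * m\<close> is a quarter of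
    \<open>1 - pmf p 1\<close>; with \<open>q < \<theta>\<close> this leaves \<open>\<rho>\<close>
    strictly below \<open>1\<close>.\<close>
  define \<theta> where "\<theta> = (1 - pmf p 1) / (4 * m)"
  have \<theta>: "0 < \<theta>" "\<theta> < 1" "\<theta> * m = (1 - pmf p 1) / 4"
  proof -
    have "1 - pmf p 1 < 4 * m" using m p1 by linarith
    then show "\<theta> < 1" using m by (simp add: \<theta>_def divide_less_eq)
  qed (use m p1 in \<open>auto simp: \<theta>_def\<close>)
  obtain \<epsilon> where \<epsilon>: "0 < \<epsilon>" "measure (gw_offspring p) {\<nu>. perc_surv L \<nu> \<le> \<epsilon>} < \<theta>"
    using exists_small_surv_prob[OF surv \<theta>(1)] by blast
  define q where "q = measure (gw_offspring p) {\<nu>. perc_surv L \<nu> \<le> \<epsilon>}"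
  define \<rho> where "\<rho> = pmf p 1 + (\<theta> + q) * m"
  have q: "0 \<le> q" "q < \<theta>" using \<epsilon> by (auto simp: q_def)
  have "q * m \<le> \<theta> * m" using q m by (intro mult_right_mono) auto
  then have \<rho>: "0 \<le> \<rho>" "\<rho> < 1" using \<theta> p1 q m by (auto simp: \<rho>_def distrib_right)
  define r where "r = (\<rho> + 1) / 2"
  have r: "0 < r" "r < 1" "\<rho> < r" using \<rho> by (auto simp: r_def)
  have Z: "AE \<nu> in gw_offspring p. \<forall>\<^sub>F n in sequentially. total_weight L \<epsilon> \<theta> n \<nu> \<le> r ^ n"
    using nn_integral_total_weight_le[OF _ assms(3) q_def] \<theta> \<rho> r
    by (intro AE_total_weight_eventually_le[where \<rho>=\<rho>]) (auto simp: \<rho>_def m_def)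
  have "0 < k" if "k \<in> set_pmf p" for k
    using that assms(1) by (metis gr0I set_pmf_iff)
  then have pos: "AE \<nu> in gw_offspring p. \<forall>u. 0 < \<nu> u"
    by (intro AE_offspring) (simp add: AE_measure_pmf_iff)
  have root: "\<not> (AE \<nu> in gw_offspring p. \<nu> [] = 1)"
  proof
    assume "AE \<nu> in gw_offspring p. \<nu> [] = 1"
    then have "(\<integral>\<^sup>+\<nu>. indicator {1} (\<nu> []) * (\<Prod>i<1. 1) \<partial>gw_offspring p) = (\<integral>\<^sup>+\<nu>. 1 \<partial>gw_offspring p)"
      by (intro nn_integral_cong_AE) (auto elim!: eventually_mono)
    then have "ennreal (pmf p 1) = 1"
      using nn_integral_branching_fixed[of 1 "\<lambda>_ _. 1" p] prob_space.emeasure_space_1[OF prob_space_gw_offspring[of p]]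
      by simp
    then show False using assms(2) by simp
  qed
  \<comment> \<open>All properties but the first hold almost surely, so without such a
    \<open>\<nu>\<close> the root would almost surely have exactly one child.\<close>
  have "\<exists>\<nu>. \<nu> [] \<noteq> 1 \<and> (\<forall>u. 0 < \<nu> u) \<and> (\<forall>u. 0 < perc_surv L (shift u \<nu>)) \<and>
      (\<forall>\<^sub>F n in sequentially. total_weight L \<epsilon> \<theta> n \<nu> \<le> r ^ n) \<and>
      measure_hausdorff_dim (rays (gw_tree \<nu>)) ray_dist (HARM lam (gw_tree \<nu>)) = ereal \<beta> \<and>
      (AE \<omega> in HARM lam (gw_tree \<nu>).
         (\<lambda>n. - (1 / real n) * ln (measure (HARM lam (gw_tree \<nu>)) (rays_through (gw_tree \<nu>) (\<omega> n)))) \<longlonglongrightarrow> \<beta>)"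
    (is "\<exists>\<nu>. \<nu> [] \<noteq> 1 \<and> ?P \<nu>")
  proof (rule ccontr)
    assume "\<nexists>\<nu>. \<nu> [] \<noteq> 1 \<and> ?P \<nu>"
    then have "?P \<nu> \<Longrightarrow> \<nu> [] = 1" for \<nu> by blast
    moreover have "AE \<nu> in gw_offspring p. ?P \<nu>"
      using pos AE_shift[OF surv] Z assms(7,8) by eventually_elim blast
    ultimately have "AE \<nu> in gw_offspring p. \<nu> [] = 1" by (rule eventually_mono[rotated])
    then show False using root by blast
  qed
  then obtain \<nu> where \<nu>: "\<nu> [] \<noteq> 1" "\<And>u. 0 < \<nu> u" "\<And>u. 0 < perc_surv L (shift u \<nu>)"
      "\<forall>\<^sub>F n in sequentially. total_weight L \<epsilon> \<theta> n \<nu> \<le> r ^ n"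
      "measure_hausdorff_dim (rays (gw_tree \<nu>)) ray_dist (HARM lam (gw_tree \<nu>)) = ereal \<beta>"
      "AE \<omega> in HARM lam (gw_tree \<nu>).
         (\<lambda>n. - (1 / real n) * ln (measure (HARM lam (gw_tree \<nu>)) (rays_through (gw_tree \<nu>) (\<omega> n)))) \<longlonglongrightarrow> \<beta>"
    by blast
  have rays: "AE \<omega> in HARM lam (gw_tree \<nu>). \<omega> \<in> rays (gw_tree \<nu>)"
    using \<nu>(5) by (intro AE_HARM_rays[where d=ray_dist]) simp
  have "AE \<omega> in HARM lam (gw_tree \<nu>). max 0 (ln lam) < \<beta>"
    using rays AE_HARM_positive[OF rays] \<nu>(6)
  proof eventually_elim
    case (elim \<omega>)
    show ?case
      by (rule ray_rate_bounds[OF assms(5) L(2,1) \<epsilon>(1) \<theta>(1,2) r(1,2) \<nu>(2,1,3,4) elim(1) _ elim(3)])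
        (use elim(2) in blast)
  qed
  \<comment> \<open>The inequality does not depend on the ray, and the harmonic measure is a
    probability measure, so holding almost everywhere means being true.\<close>
  then show ?thesis using prob_space.AE_const[OF prob_space_HARM] by simp
qed

end
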